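(* Consider the following problem: for a fixed number $M\ge2$ of quantized subsections of $[-\kappa_y,\kappa_y]=[-\kappa\tilde\theta_1,\kappa\tilde\theta_1]$, find a quantizer $q$ that minimizes $$\mathrm V[U^{\rm T}E]\;(=\mathrm V[\tilde U^{\rm T}E])=\sum_{k=1}^n\mathrm E\Big[\Big(\sum_{t=1}^N\tilde\phi_k(t)e(\tilde\phi_1(t))\Big)^2\Big]=N\int\sigma^2(\tilde\phi_1)\,e^2(\tilde\phi_1)\,f(\tilde\phi_1)\,d\tilde\phi_1$$ such that $\mathrm E_{\mathcal I_j}[\tilde\phi_1e(\tilde\phi_1)]=0$ for all $j$. Let $$\psi(r;\alpha)=\alpha r^5-18(1-r)^5+45(1+r)^2(1-r)^3+5(1-r)^7(1+r)^{-2},\qquad\xi(r;\alpha)=\alpha r^3+3(1-r)^3+\frac{(1-r)^5}{(1+r)^2}.$$ When $n=1$, the optimal ratios $r_j^o$ for this problem (where $d_j=r_jd_{j+1}$, $r_j\in[0,1]$) are given by solving the following optimization problem iteratively: $$r_j^o=\arg\min_{r\in[0,1]}\psi(r;\psi_{j-1}^{\min}),\qquad\psi_j^{\min}=\psi(r_j^o;\psi_{j-1}^{\min}),\qquad\psi_0^{\min}=32,$$ and the optimal value is given by $$\min_q\mathrm V[U^{\rm T}E]\;\big(=\min_q\mathrm V[\tilde U^{\rm T}E]\big)=\frac{N}{2160}\,\tilde\theta_1^4\kappa^4\,\psi_{M'-1}^{\min}.$$ Similarly, when $n\gg1$, the optimal ratios $r_j^o$ converge to the solution of the following optimization problem: $$r_j^o=\arg\min_{r\in[0,1]}\xi(r;\xi_{j-1}^{\min}),\qquad\xi_j^{\min}=\xi(r_j^o;\xi_{j-1}^{\min}),\qquad\xi_0^{\min}=4,$$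 and the optimal value converges to $$\frac{N}{108}\,\tilde\theta_1^4\kappa^4\,(n-1)\,\xi_{M'-1}^{\min}.$$
   Context: Setting: $\phi(t)=[u(t)\ u(t-1)\ \cdots\ u(t-n+1)]$ is the regressor vector of the finite impulse response system $y_o(t)=q(y(t))+w(t)$, $y(t)=\phi(t)\theta$, $\theta\in\mathbb R^n$, with noise $w$ independent of the input $u$. $T$ is an orthogonal matrix with $T^{-1}\theta=[\tilde\theta_1,0,\dots,0]^{\rm T}$, and $\tilde\phi=\phi T=[\tilde\phi_1\ \cdots\ \tilde\phi_n]$, so $y=\tilde\theta_1\tilde\phi_1$. $U$ is the matrix with rows $\phi(1),\dots,\phi(N)$, $\tilde U=UT$, $e(t)=q(y(t))-y(t)$ is the quantization error, written $e(\tilde\phi_1)=q(\tilde\theta_1\tilde\phi_1)-\tilde\theta_1\tilde\phi_1$ as a function of $\tilde\phi_1$, $E=[e(1)\cdots e(N)]^{\rm T}$, $N$ is the data length, and $\mathrm V[x]$ is the expectation of $\|x\|_2^2$. Assumption: $f(\phi)$ is a probability density such that the density $f(\tilde\phi)$ of $\tilde\phi$ is uniform in $\tilde\phi_i\in[-\kappa,\kappa]$ with a given $\kappa>0$. $f(\tilde\phi_1)$ is the marginal density, and $\sigma^2(\tilde\phi_1)=f(\tilde\phi_1)^{-1}\int(\sum_{k=1}^n\tilde\phi_k^2)f(\tilde\phi_1,\dots,\tilde\phi_n)\,d\tilde\phi_2\cdots d\tilde\phi_n$. Quantizer: $q$ is memoryless and symmetric about the origin, with $0=d_0<d_1<d_2<\cdots<d_{M'}=\kappa_y$,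 $d_{-j}=-d_j$, $\mathcal S_0=\{0\}$, $\mathcal S_j=(d_{j-1},d_j]$ for $j>0$, $\mathcal S_j=[d_j,d_{j+1})$ for $j<0$, and $q(y)=y'_{\langle j\rangle}$ for $y\in\mathcal S_j$. Here $M'=M/2$ for even $M$ and $M'=(M-1)/2$ for odd $M$ (for odd $M$ the constraint forces the subsection containing the origin to be $\{0\}$, so the problem reduces to the even case). $\mathcal I_j=\{\tilde\phi_1:\tilde\theta_1\tilde\phi_1\in\mathcal S_j\}$ and $\mathrm E_{\mathcal I_j}[\tilde\phi_1e(\tilde\phi_1)]=\int_{\mathcal I_j}\tilde\phi_1e(\tilde\phi_1)f(\tilde\phi_1)\,d\tilde\phi_1$. Once the boundaries $d_j$ are fixed, the values $y'_{\langle j\rangle}$ are given by the constraint, so the optimization amounts to determining the ratios $r_1,\dots,r_{M'-1}$.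
   Formalization: The factor θ̃₁⁴ in both optimal values is corrected to θ̃₁² (the printed power fails for θ̃₁≠1), and the products φ̃_k(t)g(φ̃_1(t)) are assumed uncorrelated at different times t, without which the displayed equality with N∫σ²e²f fails. *)

theory Defs
  imports "HOL-Probability.Probability" "HOL-Library.Landau_Symbols"
begin

text \<open>
  The dimension n varies (n = 1 and n tending to infinity), so vectors of length n are functions on
  \<open>{..<n}\<close> and matrices are binary functions. Components are numbered from 0: component \<open>k\<close>
  here is component \<open>k + 1\<close> of the mathematical text. Time indices run over \<open>{1..N}\<close>.
\<close>

section \<open>The regression model\<close>

definition orthogonal_mat :: "nat \<Rightarrow> (nat \<Rightarrow> nat \<Rightarrow> real) \<Rightarrow> bool" where
  "orthogonal_mat n T \<longleftrightarrow>
     (\<forall>i<n. \<forall>j<n. (\<Sum>k<n. T k i * T k j) = (if i = j then 1 else 0)) \<and>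
     (\<forall>i<n. \<forall>j<n. (\<Sum>k<n. T i k * T j k) = (if i = j then 1 else 0))"

text \<open>The row vector \<open>[u(t) u(t-1) \<dots> u(t-n+1)]\<close>, which is also row \<open>t\<close> of the matrix \<open>U\<close>.\<close>

definition regressor :: "(int \<Rightarrow> 'w \<Rightarrow> real) \<Rightarrow> 'w \<Rightarrow> nat \<Rightarrow> nat \<Rightarrow> real" where
  "regressor u \<omega> t i = u (int t - int i) \<omega>"

definition rot_regressor ::
  "nat \<Rightarrow> (int \<Rightarrow> 'w \<Rightarrow> real) \<Rightarrow> (nat \<Rightarrow> nat \<Rightarrow> real) \<Rightarrow> 'w \<Rightarrow> nat \<Rightarrow> nat \<Rightarrow> real" where
  "rot_regressor n u T \<omega> t k = (\<Sum>i<n. regressor u \<omega> t i * T i k)"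

definition noiseless_output ::
  "nat \<Rightarrow> (int \<Rightarrow> 'w \<Rightarrow> real) \<Rightarrow> (nat \<Rightarrow> real) \<Rightarrow> 'w \<Rightarrow> nat \<Rightarrow> real" where
  "noiseless_output n u \<theta> \<omega> t = (\<Sum>i<n. regressor u \<omega> t i * \<theta> i)"

text \<open>Density of the uniform distribution on the cube \<open>[-\<kappa>, \<kappa>]^n\<close>.\<close>

definition unif_density :: "nat \<Rightarrow> real \<Rightarrow> (nat \<Rightarrow> real) \<Rightarrow> real" where
  "unif_density n \<kappa> x = indicator (PiE {..<n} (\<lambda>_. {-\<kappa>..\<kappa>})) x / (2 * \<kappa>) ^ n"

text \<open>
  Since \<open>T\<close> is orthogonal, \<open>T\<inverse>\<close> is the transpose of \<open>T\<close>. Prescribing the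
  density of the rotated regressor prescribes that of the regressor, as rotations preserve volume.
  The noise added to the quantized output is absent because no quantity below involves it.
\<close>

definition fir_model ::
  "nat \<Rightarrow> nat \<Rightarrow> real \<Rightarrow> real \<Rightarrow> 'w measure \<Rightarrow> (int \<Rightarrow> 'w \<Rightarrow> real) \<Rightarrow>
   (nat \<Rightarrow> nat \<Rightarrow> real) \<Rightarrow> (nat \<Rightarrow> real) \<Rightarrow> bool" where
  "fir_model n N \<kappa> \<theta>1 P u T \<theta> \<longleftrightarrow>
     1 \<le> n \<and> prob_space P \<and> (\<forall>t. u t \<in> borel_measurable P) \<and>
     orthogonal_mat n T \<and>
     (\<forall>k<n. (\<Sum>i<n. T i k * \<theta> i) = (if k = 0 then \<theta>1 else 0)) \<and>
     (\<forall>t\<in>{1..N}. distributed P (PiM {..<n} (\<lambda>_. lborel))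
        (\<lambda>\<omega>. \<lambda>k\<in>{..<n}. rot_regressor n u T \<omega> t k) (\<lambda>x. ennreal (unif_density n \<kappa> x)))"

text \<open>
  The condition under which the objective reduces to N times a single integral: products of a
  component of the rotated regressor with a function of its leading component are uncorrelated at
  different times. It follows from independence of the regressors of different times, and it also
  holds for independent uniform inputs with \<open>T\<close> the identity, where the regressors overlap.
\<close>

definition uncorrelated_in_time ::
  "nat \<Rightarrow> nat \<Rightarrow> real \<Rightarrow> 'w measure \<Rightarrow> (int \<Rightarrow> 'w \<Rightarrow> real) \<Rightarrow> (nat \<Rightarrow> nat \<Rightarrow> real) \<Rightarrow> bool" where
  "uncorrelated_in_time n N \<kappa> P u T \<longleftrightarrow>
     (\<forall>g \<in> borel_measurable borel. bounded (g ` {-\<kappa>..\<kappa>}) \<longrightarrow>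
       (\<forall>k<n. \<forall>s\<in>{1..N}. \<forall>t\<in>{1..N}. s \<noteq> t \<longrightarrow>
         (let Z = (\<lambda>t \<omega>. rot_regressor n u T \<omega> t k * g (rot_regressor n u T \<omega> t 0))
          in (\<integral>\<omega>. Z s \<omega> * Z t \<omega> \<partial>P) = (\<integral>\<omega>. Z s \<omega> \<partial>P) * (\<integral>\<omega>. Z t \<omega> \<partial>P))))"

section \<open>Quantizers\<close>

definition cell :: "(int \<Rightarrow> real) \<Rightarrow> int \<Rightarrow> real set" where
  "cell d j = (if j = 0 then {0} else if j > 0 then {d (j - 1)<..d j} else {d j..<d (j + 1)})"

text \<open>
  \<open>m\<close> is the number of positive cells. A quantizer lives on \<open>[-\<kappa>y, \<kappa>y]\<close>; it is
  extended by 0 outside, which keeps it measurable and does not affect any quantity below.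
\<close>

definition is_quantizer :: "nat \<Rightarrow> real \<Rightarrow> (int \<Rightarrow> real) \<Rightarrow> (real \<Rightarrow> real) \<Rightarrow> bool" where
  "is_quantizer m \<kappa>y d q \<longleftrightarrow>
     d 0 = 0 \<and> (\<forall>j\<in>{0..<int m}. d j < d (j + 1)) \<and> d (int m) = \<kappa>y \<and>
     (\<forall>j\<in>{0..int m}. d (- j) = - d j) \<and>
     (\<exists>v. \<forall>j\<in>{- int m..int m}. \<forall>y\<in>cell d j. q y = v j) \<and>
     (\<forall>y. q (- y) = - q y) \<and>
     (\<forall>y. \<bar>y\<bar> > \<kappa>y \<longrightarrow> q y = 0)"

definition err_fun :: "real \<Rightarrow> (real \<Rightarrow> real) \<Rightarrow> real \<Rightarrow> real" where
  "err_fun \<theta>1 q x = q (\<theta>1 * x) - \<theta>1 * x"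

text \<open>Marginal density of the leading component; the integrals run over components \<open>1, \<dots>, n-1\<close>.\<close>

definition marg_density :: "nat \<Rightarrow> real \<Rightarrow> real \<Rightarrow> real" where
  "marg_density n \<kappa> x = (\<integral>z. unif_density n \<kappa> (z(0 := x)) \<partial>(PiM {1..<n} (\<lambda>_. lborel)))"

definition sigma_sq :: "nat \<Rightarrow> real \<Rightarrow> real \<Rightarrow> real" where
  "sigma_sq n \<kappa> x = inverse (marg_density n \<kappa> x) *
     (\<integral>z. (\<Sum>k<n. ((z(0 := x)) k)\<^sup>2) * unif_density n \<kappa> (z(0 := x)) \<partial>(PiM {1..<n} (\<lambda>_. lborel)))"

text \<open>
  The number of positive cells is \<open>M div 2\<close>, which is \<open>M/2\<close> for even and
  \<open>(M-1)/2\<close> for odd \<open>M\<close>; for odd \<open>M\<close> the central cell is the singleton \<open>{0}\<close>.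
\<close>

definition feasible ::
  "nat \<Rightarrow> real \<Rightarrow> real \<Rightarrow> nat \<Rightarrow> (int \<Rightarrow> real) \<Rightarrow> (real \<Rightarrow> real) \<Rightarrow> bool" where
  "feasible n \<kappa> \<theta>1 M d q \<longleftrightarrow>
     is_quantizer (M div 2) (\<kappa> * \<theta>1) d q \<and>
     (\<forall>j\<in>{- int (M div 2)..int (M div 2)}.
        (LINT x:{x. \<theta>1 * x \<in> cell d j}|lborel. x * err_fun \<theta>1 q x * marg_density n \<kappa> x) = 0)"

section \<open>The objective\<close>

definition mean_sq_norm :: "nat \<Rightarrow> 'w measure \<Rightarrow> ('w \<Rightarrow> nat \<Rightarrow> real) \<Rightarrow> real" where
  "mean_sq_norm n P X = (\<integral>\<omega>. (\<Sum>k<n. (X \<omega> k)\<^sup>2) \<partial>P)"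

definition transpose_mult ::
  "nat \<Rightarrow> (nat \<Rightarrow> nat \<Rightarrow> real) \<Rightarrow> (nat \<Rightarrow> real) \<Rightarrow> nat \<Rightarrow> real" where
  "transpose_mult N A e k = (\<Sum>t=1..N. A t k * e t)"

definition quant_error ::
  "nat \<Rightarrow> (int \<Rightarrow> 'w \<Rightarrow> real) \<Rightarrow> (nat \<Rightarrow> real) \<Rightarrow> (real \<Rightarrow> real) \<Rightarrow> 'w \<Rightarrow> nat \<Rightarrow> real" where
  "quant_error n u \<theta> q \<omega> t = q (noiseless_output n u \<theta> \<omega> t) - noiseless_output n u \<theta> \<omega> t"

definition V_UE ::
  "nat \<Rightarrow> nat \<Rightarrow> 'w measure \<Rightarrow> (int \<Rightarrow> 'w \<Rightarrow> real) \<Rightarrow> (nat \<Rightarrow> real) \<Rightarrow> (real \<Rightarrow> real) \<Rightarrow> real" where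
  "V_UE n N P u \<theta> q =
     mean_sq_norm n P (\<lambda>\<omega>. transpose_mult N (regressor u \<omega>) (quant_error n u \<theta> q \<omega>))"

definition V_rot_UE ::
  "nat \<Rightarrow> nat \<Rightarrow> 'w measure \<Rightarrow> (int \<Rightarrow> 'w \<Rightarrow> real) \<Rightarrow> (nat \<Rightarrow> nat \<Rightarrow> real) \<Rightarrow> (nat \<Rightarrow> real) \<Rightarrow>
   (real \<Rightarrow> real) \<Rightarrow> real" where
  "V_rot_UE n N P u T \<theta> q =
     mean_sq_norm n P (\<lambda>\<omega>. transpose_mult N (rot_regressor n u T \<omega>) (quant_error n u \<theta> q \<omega>))"

definition optimal ::
  "nat \<Rightarrow> nat \<Rightarrow> real \<Rightarrow> real \<Rightarrow> nat \<Rightarrow> 'w measure \<Rightarrow> (int \<Rightarrow> 'w \<Rightarrow> real) \<Rightarrow> (nat \<Rightarrow> real) \<Rightarrow>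
   (int \<Rightarrow> real) \<Rightarrow> (real \<Rightarrow> real) \<Rightarrow> bool" where
  "optimal n N \<kappa> \<theta>1 M P u \<theta> d q \<longleftrightarrow>
     is_arg_min (\<lambda>(d, q). V_UE n N P u \<theta> q) (\<lambda>(d, q). feasible n \<kappa> \<theta>1 M d q) (d, q)"

section \<open>The recursions\<close>

definition psi :: "real \<Rightarrow> real \<Rightarrow> real" where
  "psi r \<alpha> = \<alpha> * r ^ 5 - 18 * (1 - r) ^ 5 + 45 * (1 + r)\<^sup>2 * (1 - r) ^ 3
     + 5 * (1 - r) ^ 7 * (1 + r) powi (- 2)"

definition xi :: "real \<Rightarrow> real \<Rightarrow> real" where
  "xi r \<alpha> = \<alpha> * r ^ 3 + 3 * (1 - r) ^ 3 + (1 - r) ^ 5 / (1 + r)\<^sup>2"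

primrec psi_min :: "nat \<Rightarrow> real" where
  "psi_min 0 = 32"
| "psi_min (Suc j) = psi (arg_min_on (\<lambda>r. psi r (psi_min j)) {0..1}) (psi_min j)"

primrec xi_min :: "nat \<Rightarrow> real" where
  "xi_min 0 = 4"
| "xi_min (Suc j) = xi (arg_min_on (\<lambda>r. xi r (xi_min j)) {0..1}) (xi_min j)"

text \<open>The ratios, meaningful for \<open>j \<ge> 1\<close>.\<close>

definition psi_ratio :: "nat \<Rightarrow> real" where
  "psi_ratio j = arg_min_on (\<lambda>r. psi r (psi_min (j - 1))) {0..1}"

definition xi_ratio :: "nat \<Rightarrow> real" where
  "xi_ratio j = arg_min_on (\<lambda>r. xi r (xi_min (j - 1))) {0..1}"

end

theory Submission
  imports Defs "HOL-Real_Asymp.Real_Asymp"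
begin

text \<open>
  The orthogonality constraint fixes the value of the quantizer on each cell \<open>(a, b]\<close>, namely a multiple of
  the centroid of the cell with respect to the density proportional to \<open>x\<close> (\<open>cell_moment_zero_iff\<close>).
  Only the cell boundaries remain to be chosen.

  The constraint also makes the summands of the objective centred. Uncorrelatedness in time therefore removes
  all mixed terms, and the objective becomes \<open>N\<close> times the integral of the squared error against
  \<open>x\<^sup>2 + (n - 1) * \<kappa>\<^sup>2 / 3\<close> under the uniform density (\<open>V_rot_UE_eq\<close>, \<open>sigma_sq_marg_density\<close>). A cell
  \<open>(a, b]\<close> contributes a combination of \<open>b ^ 5 * psi (a / b) 0\<close>, from the weight \<open>x\<^sup>2\<close>, and of
  \<open>b ^ 3 * xi (a / b) 0\<close>, from the constant weight (\<open>cell_error_integral\<close>). Both are homogeneous, so in the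
  ratios of consecutive boundaries the total cost is a nested expression in which the cells below a boundary
  enter as a scaled copy of a smaller problem (\<open>nested_cost\<close>, \<open>V_UE_feasible\<close>). Its minimization is
  dynamic programming with the one-step functions \<open>psi r \<alpha>\<close> and \<open>xi r \<alpha>\<close>, where \<open>\<alpha>\<close> is the optimal
  cost of the smaller problem (\<open>ratio_recursion\<close>). Each one-step problem has a unique and interior minimizer
  (\<open>psi_min_and_ratio\<close>, \<open>xi_min_and_ratio\<close>).

  For \<open>n = 1\<close> only the \<open>psi\<close>-cost is present and the solution is exact. For large \<open>n\<close> the \<open>xi\<close>-cost
  dominates. The minimizers of the two-term cost have \<open>xi\<close>-cost tending to the minimum, and uniqueness at
  each step turns this into convergence of all ratios (\<open>ratios_tendsto\<close>). Since the limit ratios are interior, the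
  minimizers over the compact cube of ratios eventually belong to genuine partitions, which also
  gives the existence of optimal quantizers (\<open>optimal_many_inputs\<close>).
\<close>

section \<open>The recursion in the ratios\<close>

text \<open>
  The cost of a partition of \<open>[0, 1]\<close> into \<open>k + 1\<close> cells with boundaries \<open>x j = r j * x (j + 1)\<close>, when
  the cell \<open>(a, b]\<close> costs \<open>b ^ p * c (a / b)\<close>. By homogeneity the cells below \<open>x k\<close> form a scaled
  copy of a smaller partition, which gives the recursion; the lowest cell has ratio \<open>0\<close>. In these
  coordinates the admissible set is a cube and the cost is continuous up to its boundary, even where
  cells degenerate and \<open>a / b\<close> loses its meaning.
\<close>

primrec nested_cost :: "nat \<Rightarrow> (real \<Rightarrow> real) \<Rightarrow> nat \<Rightarrow> (nat \<Rightarrow> real) \<Rightarrow> real" where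
  "nested_cost p c 0 r = c 0"
| "nested_cost p c (Suc k) r = nested_cost p c k r * r (Suc k) ^ p + c (r (Suc k))"

text \<open>
  Outside a ball around the minimizer, the minimum over the remaining compact set exceeds the global one
  by a positive gap, so values close to the minimum force points close to the minimizer.
\<close>

lemma tendsto_unique_minimizer:
  fixes f :: "'a::metric_space \<Rightarrow> real"
  assumes S: "compact S" and f: "continuous_on S f"
    and less: "\<And>x. x \<in> S \<Longrightarrow> x \<noteq> a \<Longrightarrow> f a < f x"
    and X: "\<forall>\<^sub>F n in F. X n \<in> S" and lim: "((\<lambda>n. f (X n)) \<longlongrightarrow> f a) F"
  shows "(X \<longlongrightarrow> a) F"
proof (rule tendstoI)
  fix e :: real assume e: "0 < e"
  define K where "K = S \<inter> {x. e \<le> dist x a}"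
  have K: "compact K"
    unfolding K_def by (intro compact_Int_closed S closed_Collect_le continuous_intros)
  show "\<forall>\<^sub>F n in F. dist (X n) a < e"
  proof (cases "K = {}")
    case True
    show ?thesis
      using X by eventually_elim (use True in \<open>auto simp: K_def not_le\<close>)
  next
    case False
    have "continuous_on K f" using f by (rule continuous_on_subset) (auto simp: K_def)
    then obtain y where y: "y \<in> K" "\<And>x. x \<in> K \<Longrightarrow> f y \<le> f x"
      using continuous_attains_inf[OF K False] by blast
    have "f a < f y" using y(1) e by (intro less) (auto simp: K_def)
    then have "\<forall>\<^sub>F n in F. f (X n) < f y" using lim by (simp add: order_tendsto_iff)
    with X show ?thesis
      by eventually_elim (use y(2) in \<open>force simp: K_def not_le\<close>)
  qed
qed

text \<open>
  The functions \<open>psi\<close> and \<open>xi\<close> are sums of a multiple of \<open>r ^ p\<close> and a function \<open>c\<close> that is fixed.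
  The function \<open>psi\<close> is not convex in \<open>r\<close> near \<open>0\<close>, so unimodality is obtained
  differently: dividing the derivative by \<open>r ^ (p - 1)\<close> leaves \<open>p * \<alpha> - g r\<close>, and as soon as \<open>g\<close> decreases strictly from infinity to \<open>0\<close> this
  changes sign exactly once, from negative to positive, whatever the value of \<open>\<alpha> > 0\<close>.
\<close>

lemma unique_minimizer_power_plus:
  fixes c c' g :: "real \<Rightarrow> real" and \<alpha> :: real
  assumes \<alpha>: "0 < \<alpha>" and p: "0 < p"
    and c: "continuous_on {0..1} c"
    and c': "\<And>r. 0 < r \<Longrightarrow> r < 1 \<Longrightarrow> (c has_real_derivative - (r ^ (p - 1) * g r)) (at r)"
    and g: "continuous_on {0<..1} g" and g1: "g 1 = 0"
    and anti: "\<And>a b. 0 < a \<Longrightarrow> a < b \<Longrightarrow> b \<le> 1 \<Longrightarrow> g b < g a"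
    and unbounded: "\<And>K. \<exists>r. 0 < r \<and> r < 1 \<and> K < g r"
  shows "\<exists>\<rho>. 0 < \<rho> \<and> \<rho> < 1 \<and>
    (\<forall>r\<in>{0..1}. r \<noteq> \<rho> \<longrightarrow> \<alpha> * \<rho> ^ p + c \<rho> < \<alpha> * r ^ p + c r)"
proof -
  define f where "f r = \<alpha> * r ^ p + c r" for r
  obtain a where a: "0 < a" "a < 1" "real p * \<alpha> < g a" using unbounded by blast
  have "\<exists>\<rho>. a \<le> \<rho> \<and> \<rho> \<le> 1 \<and> g \<rho> = real p * \<alpha>"
    by (rule IVT2') (use a g1 \<alpha> in \<open>auto intro!: continuous_on_subset[OF g]\<close>)
  then obtain \<rho> where \<rho>: "a \<le> \<rho>" "\<rho> \<le> 1" "g \<rho> = real p * \<alpha>" by blast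
  have \<rho>1: "\<rho> \<noteq> 1" using \<rho> g1 \<alpha> p by auto
  have pos: "0 < \<rho>" "\<rho> < 1" using \<rho> a \<rho>1 by auto
  have cont: "continuous_on {0..1} f" unfolding f_def by (intro continuous_intros c)
  have der: "(f has_real_derivative r ^ (p - 1) * (real p * \<alpha> - g r)) (at r)" if "0 < r" "r < 1" for r
    unfolding f_def
    by (rule derivative_eq_intros c' that refl)+ (auto simp: algebra_simps)
  have "f \<rho> < f r" if r: "r \<in> {0..1}" "r \<noteq> \<rho>" for r
  proof (cases "r < \<rho>")
    case True
    have "(- f) r < (- f) \<rho>"
    proof (rule DERIV_pos_imp_increasing_open[OF True])
      fix x assume x: "r < x" "x < \<rho>"
      have "g \<rho> < g x" using x r pos by (intro anti) auto
      then have "0 < - (x ^ (p - 1) * (real p * \<alpha> - g x))"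
        using x r \<rho> by (simp add: mult_less_0_iff)
      moreover have "((- f) has_real_derivative - (x ^ (p - 1) * (real p * \<alpha> - g x))) (at x)"
        unfolding fun_Compl_def using x r pos by (intro DERIV_minus der) auto
      ultimately show "\<exists>y. ((- f) has_real_derivative y) (at x) \<and> 0 < y" by blast
    next
      show "continuous_on {r..\<rho>} (- f)"
        unfolding fun_Compl_def
        by (intro continuous_intros continuous_on_subset[OF cont]) (use r pos in auto)
    qed
    then show ?thesis by simp
  next
    case False
    then have less: "\<rho> < r" using r by simp
    show ?thesis
    proof (rule DERIV_pos_imp_increasing_open[OF less])
      fix x assume x: "\<rho> < x" "x < r"
      have "g x < g \<rho>" using x r pos by (intro anti) auto
      then have "0 < x ^ (p - 1) * (real p * \<alpha> - g x)"
        using x pos \<rho> by simp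
      moreover have "(f has_real_derivative x ^ (p - 1) * (real p * \<alpha> - g x)) (at x)"
        using x r pos by (intro der) auto
      ultimately show "\<exists>y. (f has_real_derivative y) (at x) \<and> 0 < y" by blast
    next
      show "continuous_on {\<rho>..r} f"
        by (intro continuous_on_subset[OF cont]) (use r pos in auto)
    qed
  qed
  then show ?thesis using pos unfolding f_def by blast
qed

lemma is_arg_min_unique_iff:
  fixes f :: "'a \<Rightarrow> 'b::linorder"
  assumes "a \<in> S" and "\<And>x. x \<in> S \<Longrightarrow> x \<noteq> a \<Longrightarrow> f a < f x"
  shows "is_arg_min f (\<lambda>x. x \<in> S) r \<longleftrightarrow> r = a"
  using assms unfolding is_arg_min_def by (metis order.asym order.irrefl)

lemma arg_min_on_unique:
  fixes f :: "'a \<Rightarrow> 'b::linorder"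
  assumes "a \<in> S" and "\<And>x. x \<in> S \<Longrightarrow> x \<noteq> a \<Longrightarrow> f a < f x"
  shows "arg_min_on f S = a"
  unfolding arg_min_on_def arg_min_def
  by (rule some_equality) (use is_arg_min_unique_iff[of a S f, OF assms] in blast)+

text \<open>
  Dynamic programming for \<open>nested_cost\<close>: \<open>\<alpha> k\<close> is the optimal cost of \<open>k + 1\<close> cells, and
  \<open>\<rho> (Suc k)\<close> is the unique optimal position of the last interior boundary once the cells below it are
  optimal. Both recursions of the theorem are instances, with \<open>p = 5\<close> and \<open>p = 3\<close>.
\<close>

locale ratio_recursion =
  fixes p :: nat and c :: "real \<Rightarrow> real" and \<alpha> \<rho> :: "nat \<Rightarrow> real"
  assumes exponent_pos: "0 < p"
    and cost_continuous: "continuous_on {0..1} c"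
    and value_0: "\<alpha> 0 = c 0"
    and value_Suc: "\<alpha> (Suc j) = \<alpha> j * \<rho> (Suc j) ^ p + c (\<rho> (Suc j))"
    and ratio_unique: "r \<in> {0..1} \<Longrightarrow> r \<noteq> \<rho> (Suc j) \<Longrightarrow> \<alpha> (Suc j) < \<alpha> j * r ^ p + c r"
    and ratio_pos: "0 < \<rho> (Suc j)"
    and ratio_less_1: "\<rho> (Suc j) < 1"
begin

lemma value_le: "r \<in> {0..1} \<Longrightarrow> \<alpha> (Suc j) \<le> \<alpha> j * r ^ p + c r"
  using ratio_unique[of r j] value_Suc[of j] by (cases "r = \<rho> (Suc j)") auto

lemma nested_cost_ge:
  assumes "\<And>j. j \<in> {1..k} \<Longrightarrow> r j \<in> {0..1}"
  shows "\<alpha> k \<le> nested_cost p c k r"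
  using assms
proof (induction k)
  case 0
  then show ?case by (simp add: value_0)
next
  case (Suc k)
  have r: "r (Suc k) \<in> {0..1}" using Suc.prems by auto
  have "\<alpha> (Suc k) \<le> \<alpha> k * r (Suc k) ^ p + c (r (Suc k))" using r by (rule value_le)
  also have "\<dots> \<le> nested_cost p c (Suc k) r"
    using Suc r by (auto intro!: mult_right_mono)
  finally show ?case .
qed

lemma nested_cost_eq_iff:
  assumes "\<And>j. j \<in> {1..k} \<Longrightarrow> r j \<in> {0..1}"
  shows "nested_cost p c k r = \<alpha> k \<longleftrightarrow> (\<forall>j\<in>{1..k}. r j = \<rho> j)"
  using assms
proof (induction k)
  case 0
  then show ?case by (simp add: value_0)
next
  case (Suc k)
  define s where "s = r (Suc k)"
  have s: "s \<in> {0..1}" using Suc.prems by (auto simp: s_def)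
  have ge: "\<alpha> k \<le> nested_cost p c k r" by (rule nested_cost_ge) (use Suc.prems in auto)
  have IH: "nested_cost p c k r = \<alpha> k \<longleftrightarrow> (\<forall>j\<in>{1..k}. r j = \<rho> j)"
    by (rule Suc.IH) (use Suc.prems in auto)
  have sp: "0 \<le> (nested_cost p c k r - \<alpha> k) * s ^ p"
    using ge s by simp
  have "nested_cost p c (Suc k) r = \<alpha> (Suc k) \<longleftrightarrow> nested_cost p c k r = \<alpha> k \<and> s = \<rho> (Suc k)"
  proof
    assume eq: "nested_cost p c (Suc k) r = \<alpha> (Suc k)"
    have "s = \<rho> (Suc k)"
      using eq sp ratio_unique[of s k] s by (fastforce simp: s_def algebra_simps)
    moreover from this have "(nested_cost p c k r - \<alpha> k) * s ^ p = 0"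
      using eq value_Suc[of k] by (simp add: s_def algebra_simps)
    ultimately show "nested_cost p c k r = \<alpha> k \<and> s = \<rho> (Suc k)"
      using ratio_pos[of k] by auto
  next
    assume "nested_cost p c k r = \<alpha> k \<and> s = \<rho> (Suc k)"
    then show "nested_cost p c (Suc k) r = \<alpha> (Suc k)" by (simp add: s_def value_Suc)
  qed
  also have "\<dots> \<longleftrightarrow> (\<forall>j\<in>{1..Suc k}. r j = \<rho> j)"
    unfolding IH s_def by (auto simp: le_Suc_eq)
  finally show ?case .
qed

text \<open>
  The asymptotic form of \<open>nested_cost_eq_iff\<close>. The excess of the cost over \<open>\<alpha> (Suc k)\<close> is a sum of
  two nonnegative terms, the weighted excess of the inner cells and the excess of the one-step
  problem. Both vanish in the limit: the second one forces the last ratio to converge, and then the weight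
  of the first one, which tends to a positive number, can be divided out.
\<close>

lemma ratios_tendsto:
  assumes R: "\<forall>\<^sub>F n in F. \<forall>j\<in>{1..k}. R n j \<in> {0..1}"
    and lim: "((\<lambda>n. nested_cost p c k (R n)) \<longlongrightarrow> \<alpha> k) F"
    and j: "j \<in> {1..k}"
  shows "((\<lambda>n. R n j) \<longlongrightarrow> \<rho> j) F"
  using assms
proof (induction k arbitrary: j)
  case 0
  then show ?case by simp
next
  case (Suc k)
  define s where "s n = R n (Suc k)" for n
  have s: "\<forall>\<^sub>F n in F. s n \<in> {0..1}"
    using Suc.prems(1) by eventually_elim (auto simp: s_def)
  have Rk: "\<forall>\<^sub>F n in F. \<forall>j\<in>{1..k}. R n j \<in> {0..1}"
    using Suc.prems(1) by eventually_elim auto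
  have ge: "\<forall>\<^sub>F n in F. \<alpha> k \<le> nested_cost p c k (R n)"
    using Rk by eventually_elim (intro nested_cost_ge, auto)
  define f where "f r = \<alpha> k * r ^ p + c r" for r
  have f\<rho>: "f (\<rho> (Suc k)) = \<alpha> (Suc k)" by (simp add: f_def value_Suc)
  have cost: "nested_cost p c (Suc k) (R n) = (nested_cost p c k (R n) - \<alpha> k) * s n ^ p + f (s n)" for n
    by (simp add: s_def f_def algebra_simps)
  have flim: "((\<lambda>n. f (s n)) \<longlongrightarrow> \<alpha> (Suc k)) F"
  proof (rule tendsto_sandwich[OF _ _ tendsto_const Suc.prems(2)])
    show "\<forall>\<^sub>F n in F. \<alpha> (Suc k) \<le> f (s n)"
      using s by eventually_elim (auto simp: f_def intro!: value_le)
    show "\<forall>\<^sub>F n in F. f (s n) \<le> nested_cost p c (Suc k) (R n)"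
      using s ge by eventually_elim (unfold cost, simp)
  qed
  have slim: "(s \<longlongrightarrow> \<rho> (Suc k)) F"
  proof (rule tendsto_unique_minimizer[of "{0..1}" f])
    show "continuous_on {0..1} f" unfolding f_def by (intro continuous_intros cost_continuous)
    show "f (\<rho> (Suc k)) < f x" if "x \<in> {0..1}" "x \<noteq> \<rho> (Suc k)" for x
      using ratio_unique[OF that] by (simp add: f\<rho>) (simp add: f_def)
  qed (use s flim in \<open>simp_all add: f\<rho>\<close>)
  have "((\<lambda>n. (nested_cost p c (Suc k) (R n) - f (s n)) / s n ^ p + \<alpha> k) \<longlongrightarrow>
      (\<alpha> (Suc k) - \<alpha> (Suc k)) / \<rho> (Suc k) ^ p + \<alpha> k) F"
    using ratio_pos[of k] by (intro tendsto_intros Suc.prems(2) flim slim) auto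
  moreover have "\<forall>\<^sub>F n in F. (nested_cost p c (Suc k) (R n) - f (s n)) / s n ^ p + \<alpha> k
      = nested_cost p c k (R n)"
  proof -
    have "\<forall>\<^sub>F n in F. 0 < s n" using slim ratio_pos[of k] by (simp add: order_tendsto_iff)
    then show ?thesis by eventually_elim (unfold cost, simp)
  qed
  ultimately have "((\<lambda>n. nested_cost p c k (R n)) \<longlongrightarrow>
      (\<alpha> (Suc k) - \<alpha> (Suc k)) / \<rho> (Suc k) ^ p + \<alpha> k) F"
    by (rule Lim_transform_eventually)
  then have lim_k: "((\<lambda>n. nested_cost p c k (R n)) \<longlongrightarrow> \<alpha> k) F" by simp
  show ?case
  proof (cases "j = Suc k")
    case True
    then show ?thesis using slim by (simp add: s_def[abs_def])
  next
    case False
    then show ?thesis using Suc.prems(3) by (intro Suc.IH Rk lim_k) auto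
  qed
qed

end

lemma continuous_on_nested_cost:
  assumes "continuous_on {0..1} c"
  shows "continuous_on (UNIV \<rightarrow>\<^sub>E {0..1}) (nested_cost p c k)"
proof (induction k)
  case (Suc k)
  have coord: "continuous_on (UNIV \<rightarrow>\<^sub>E {0..1}) (\<lambda>r::nat \<Rightarrow> real. r (Suc k))"
    by (rule continuous_on_subset[OF continuous_on_product_coordinates]) simp
  have "continuous_on (UNIV \<rightarrow>\<^sub>E {0..1}) (\<lambda>r. c (r (Suc k)))"
    by (rule continuous_on_compose2[OF assms coord]) auto
  with Suc coord show ?case by (auto intro!: continuous_intros)
qed simp

lemma compact_ratio_cube: "compact ((UNIV :: nat set) \<rightarrow>\<^sub>E {0..1::real})"
proof -
  have "compactin (product_topology (\<lambda>i::nat. euclidean :: real topology) UNIV)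
          ((UNIV :: nat set) \<rightarrow>\<^sub>E {0..1::real})"
    by (subst compactin_PiE) auto
  then show ?thesis by (simp add: euclidean_product_topology)
qed

section \<open>The one-step problems\<close>

lemma continuous_on_psi: "continuous_on {0..1} (\<lambda>r. psi r 0)"
proof -
  have eq: "(\<lambda>r. psi r 0) = (\<lambda>r. - 18 * (1 - r) ^ 5 + 45 * (1 + r)\<^sup>2 * (1 - r) ^ 3
     + 5 * (1 - r) ^ 7 / (1 + r) ^ 2)"
    by (auto simp: psi_def power_int_minus divide_inverse)
  show ?thesis unfolding eq by (intro continuous_intros) auto
qed

lemma continuous_on_xi: "continuous_on {0..1} (\<lambda>r. xi r 0)"
  unfolding xi_def by (intro continuous_intros) auto

text \<open>
  The derivative of \<open>\<lambda>r. psi r 0\<close> factors as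
  \<open>- 80 * r * (1 - r)\<^sup>2 * (2 + 19 * r + 21 * r\<^sup>2 + 10 * r ^ 3 + 2 * r ^ 4) / (1 + r) ^ 3\<close>.
  Divided by \<open>- (r ^ 4)\<close> it is the function \<open>g\<close> below, a product of decreasing functions, so that
  the one-step problem has a unique minimizer and it is interior. Positivity of the optimal values is
  carried along, since the criterion asks for a positive leading coefficient.
\<close>

lemma psi_min_and_ratio:
  "0 < psi_min j \<and> 0 < psi_ratio (Suc j) \<and> psi_ratio (Suc j) < 1 \<and>
   (\<forall>r\<in>{0..1}. r \<noteq> psi_ratio (Suc j) \<longrightarrow> psi_min (Suc j) < psi r (psi_min j))"
proof -
  let ?c = "\<lambda>r. psi r 0"
  define X :: "real \<Rightarrow> real" where
    "X r = 80 * (2 / r ^ 3 + 19 / r ^ 2 + 10 + (21 / r + 2 * r)) / (1 + r) ^ 3" for r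
  define g where "g r = (1 - r) ^ 2 * X r" for r
  have psi_eq: "psi r \<alpha> = \<alpha> * r ^ 5 + ?c r" for r \<alpha> by (simp add: psi_def)
  have c_alt: "?c = (\<lambda>r. - 18 * (1 - r) ^ 5 + 45 * (1 + r)\<^sup>2 * (1 - r) ^ 3
     + 5 * (1 - r) ^ 7 / (1 + r) ^ 2)"
    by (auto simp: psi_def power_int_minus divide_inverse)
  note c = continuous_on_psi
  have c': "(?c has_real_derivative - (r ^ (5 - 1) * g r)) (at r)" if r: "0 < r" "r < 1" for r
  proof -
    have "(?c has_real_derivative 90 * (1 - r) ^ 4 + 90 * (1 + r) * (1 - r) ^ 3
        - 135 * (1 + r)\<^sup>2 * (1 - r)\<^sup>2
        - 5 * (7 * (1 - r) ^ 6 * (1 + r)\<^sup>2 + (1 - r) ^ 7 * (2 * (1 + r))) / ((1 + r)\<^sup>2 * (1 + r)\<^sup>2)) (at r)"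
      unfolding c_alt
      apply (rule derivative_eq_intros refl | use r in force)+
      apply (simp add: algebra_simps add_divide_distrib diff_divide_distrib)
      done
    moreover have "90 * (1 - r) ^ 4 + 90 * (1 + r) * (1 - r) ^ 3
        - 135 * (1 + r)\<^sup>2 * (1 - r)\<^sup>2
        - 5 * (7 * (1 - r) ^ 6 * (1 + r)\<^sup>2 + (1 - r) ^ 7 * (2 * (1 + r))) / ((1 + r)\<^sup>2 * (1 + r)\<^sup>2)
      = - (r ^ (5 - 1) * g r)"
    proof -
      have "1 + r \<noteq> 0" "r \<noteq> 0" using r by auto
      then show ?thesis unfolding g_def X_def
        by (simp add: divide_simps) algebra
    qed
    ultimately show ?thesis by simp
  qed
  have g: "continuous_on {0<..1} g"
    unfolding g_def X_def by (intro continuous_intros) auto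
  have X_anti: "X b \<le> X a" and X_pos: "0 < X a" if "0 < a" "a < b" "b \<le> 1" for a b
  proof -
    \<comment> \<open>the term \<open>2 * r\<close> increases, but \<open>21 / r\<close> outweighs it on the unit interval\<close>
    have "a * b \<le> 1" using that by (simp add: mult_le_one)
    then have "(b - a) * (2 * (a * b)) \<le> (b - a) * 21" using that by (intro mult_left_mono) auto
    then have le1: "21 / b + 2 * b \<le> 21 / a + 2 * a"
      using that by (simp add: divide_simps) (simp add: algebra_simps)
    have le2: "2 / b ^ 3 \<le> 2 / a ^ 3" and le3: "19 / b ^ 2 \<le> 19 / a ^ 2"
      using that by (auto intro!: divide_left_mono power_mono)
    have "80 * (2 / b ^ 3 + 19 / b ^ 2 + 10 + (21 / b + 2 * b))
        \<le> 80 * (2 / a ^ 3 + 19 / a ^ 2 + 10 + (21 / a + 2 * a))"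
      by (intro mult_left_mono add_mono[OF add_mono[OF add_mono[OF le2 le3] order_refl] le1]) simp
    then show "X b \<le> X a"
      unfolding X_def using that by (intro frac_le[OF _ _ _ power_mono]) auto
    show "0 < X a"
      unfolding X_def using that by (intro divide_pos_pos mult_pos_pos add_pos_pos) auto
  qed
  have anti: "g b < g a" if "0 < a" "a < b" "b \<le> 1" for a b
  proof -
    have "g b \<le> (1 - b) ^ 2 * X a" unfolding g_def using that by (intro mult_left_mono X_anti) auto
    also have "\<dots> < g a" unfolding g_def
      using that X_pos[OF that] by (intro mult_strict_right_mono power_strict_mono) auto
    finally show ?thesis .
  qed
  have unbounded: "\<exists>r. 0 < r \<and> r < 1 \<and> K < g r" for K
  proof -
    \<comment> \<open>the witness is chosen such that \<open>(1 - r) / r = L\<close>\<close>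
    define L where "L = max K 1"
    define r where "r = 1 / (1 + L)"
    have L: "1 \<le> L" "K \<le> L" by (auto simp: L_def)
    have r: "0 < r" "r < 1" using L by (auto simp: r_def)
    have "(1 + r) ^ 3 \<le> 8" using power_mono[of "1 + r" 2 3] r by simp
    then have "80 * (19 / r ^ 2) / 8 \<le> X r" unfolding X_def
      using r by (intro frac_le mult_left_mono) (auto simp: add.assoc intro!: add_increasing add_increasing2)
    then have "(1 - r) ^ 2 * (80 * (19 / r ^ 2) / 8) \<le> g r" unfolding g_def
      by (intro mult_left_mono) auto
    moreover have "(1 - r) ^ 2 * (80 * (19 / r ^ 2) / 8) = 190 * ((1 - r) / r) ^ 2"
      by (simp add: power_divide)
    moreover have "(1 - r) / r = L" using L by (simp add: r_def field_simps)
    moreover have "L * 1 \<le> L * L" using L by (intro mult_left_mono) auto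
    ultimately have "L \<le> L * L" "190 * (L * L) \<le> g r" by (simp_all add: power2_eq_square)
    then have "K < g r" using L by linarith
    then show ?thesis using r by blast
  qed
  have c_nonneg: "0 \<le> ?c r" if "r \<in> {0..1}" for r
  proof -
    have "1 * (1 - r) ^ 3 \<le> (1 + r)\<^sup>2 * (1 - r) ^ 3" using that by (intro mult_right_mono) auto
    moreover have "(1 - r) ^ 5 \<le> (1 - r) ^ 3" using that by (intro power_decreasing) auto
    moreover have "0 \<le> (1 - r) ^ 3" "0 \<le> 5 * (1 - r) ^ 7 / (1 + r) ^ 2" using that by auto
    moreover have "?c r = - 18 * (1 - r) ^ 5 + 45 * ((1 + r)\<^sup>2 * (1 - r) ^ 3)
     + 5 * (1 - r) ^ 7 / (1 + r) ^ 2" unfolding fun_cong[OF c_alt] by simp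
    ultimately show ?thesis by linarith
  qed
  have step: "0 < psi_ratio (Suc j) \<and> psi_ratio (Suc j) < 1 \<and>
     (\<forall>r\<in>{0..1}. r \<noteq> psi_ratio (Suc j) \<longrightarrow> psi_min (Suc j) < psi r (psi_min j))"
    if pos: "0 < psi_min j" for j
  proof -
    obtain \<rho> where \<rho>: "0 < \<rho>" "\<rho> < 1"
      "\<And>r. r \<in> {0..1} \<Longrightarrow> r \<noteq> \<rho> \<Longrightarrow> psi \<rho> (psi_min j) < psi r (psi_min j)"
      using unique_minimizer_power_plus[OF pos _ c c' g _ anti unbounded]
      by (force simp: psi_eq[of _ "psi_min j"] g_def)
    have "psi_ratio (Suc j) = \<rho>"
      unfolding psi_ratio_def using \<rho> by (intro arg_min_on_unique) auto
    moreover from this have "psi_min (Suc j) = psi \<rho> (psi_min j)"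
      by (simp add: psi_ratio_def)
    ultimately show ?thesis using \<rho> by auto
  qed
  have "0 < psi_min j"
  proof (induction j)
    case (Suc j)
    have "psi_min (Suc j) = psi_min j * psi_ratio (Suc j) ^ 5 + ?c (psi_ratio (Suc j))"
      by (simp add: psi_ratio_def psi_eq[of _ "psi_min j"])
    moreover have "0 < psi_min j * psi_ratio (Suc j) ^ 5" using step[OF Suc] Suc by simp
    moreover have "0 \<le> ?c (psi_ratio (Suc j))" using step[OF Suc] by (intro c_nonneg) auto
    ultimately show ?case by linarith
  qed simp
  with step[OF this] show ?thesis by blast
qed

text \<open>
  The same argument with \<open>p = 3\<close>, where every factor of \<open>g\<close> is visibly decreasing.
\<close>

lemma xi_min_and_ratio:
  "0 < xi_min j \<and> 0 < xi_ratio (Suc j) \<and> xi_ratio (Suc j) < 1 \<and>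
   (\<forall>r\<in>{0..1}. r \<noteq> xi_ratio (Suc j) \<longrightarrow> xi_min (Suc j) < xi r (xi_min j))"
proof -
  let ?c = "\<lambda>r. xi r 0"
  define X :: "real \<Rightarrow> real" where
    "X r = (9 + 5 * ((1 - r) / (1 + r)) ^ 2 + 2 * ((1 - r) / (1 + r)) ^ 3) / r ^ 2" for r
  define g where "g r = (1 - r) ^ 2 * X r" for r
  have xi_eq: "xi r \<alpha> = \<alpha> * r ^ 3 + ?c r" for r \<alpha> by (simp add: xi_def)
  have c_alt: "?c = (\<lambda>r. 3 * (1 - r) ^ 3 + (1 - r) ^ 5 / (1 + r)\<^sup>2)"
    by (auto simp: xi_def)
  note c = continuous_on_xi
  have c': "(?c has_real_derivative - (r ^ (3 - 1) * g r)) (at r)" if r: "0 < r" "r < 1" for r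
  proof -
    have "(?c has_real_derivative - 9 * (1 - r)\<^sup>2
        - (5 * (1 - r) ^ 4 * (1 + r)\<^sup>2 + (1 - r) ^ 5 * (2 * (1 + r))) / ((1 + r)\<^sup>2 * (1 + r)\<^sup>2)) (at r)"
      unfolding c_alt
      apply (rule derivative_eq_intros refl | use r in force)+
      apply (simp add: algebra_simps add_divide_distrib diff_divide_distrib)
      done
    moreover have "- 9 * (1 - r)\<^sup>2
        - (5 * (1 - r) ^ 4 * (1 + r)\<^sup>2 + (1 - r) ^ 5 * (2 * (1 + r))) / ((1 + r)\<^sup>2 * (1 + r)\<^sup>2)
      = - (r ^ (3 - 1) * g r)"
    proof -
      have "1 + r \<noteq> 0" "r \<noteq> 0" using r by auto
      then show ?thesis unfolding g_def X_def
        by (simp add: divide_simps) algebra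
    qed
    ultimately show ?thesis by simp
  qed
  have g: "continuous_on {0<..1} g"
    unfolding g_def X_def by (intro continuous_intros) auto
  have X_anti: "X b \<le> X a" and X_pos: "0 < X a" if "0 < a" "a < b" "b \<le> 1" for a b
  proof -
    have "(1 - b) / (1 + b) \<le> (1 - a) / (1 + a)" using that by (intro frac_le) auto
    then show "X b \<le> X a"
      unfolding X_def using that by (intro frac_le mult_left_mono add_mono power_mono) auto
    show "0 < X a"
      unfolding X_def using that by (intro divide_pos_pos add_pos_nonneg) auto
  qed
  have anti: "g b < g a" if "0 < a" "a < b" "b \<le> 1" for a b
  proof -
    have "g b \<le> (1 - b) ^ 2 * X a" unfolding g_def using that by (intro mult_left_mono X_anti) auto
    also have "\<dots> < g a" unfolding g_def
      using that X_pos[OF that] by (intro mult_strict_right_mono power_strict_mono) auto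
    finally show ?thesis .
  qed
  have unbounded: "\<exists>r. 0 < r \<and> r < 1 \<and> K < g r" for K
  proof -
    \<comment> \<open>the witness is chosen such that \<open>(1 - r) / r = L\<close>\<close>
    define L where "L = max K 1"
    define r where "r = 1 / (1 + L)"
    have L: "1 \<le> L" "K \<le> L" by (auto simp: L_def)
    have r: "0 < r" "r < 1" using L by (auto simp: r_def)
    have "9 / r ^ 2 \<le> X r" unfolding X_def
      using r by (intro divide_right_mono) auto
    then have "(1 - r) ^ 2 * (9 / r ^ 2) \<le> g r" unfolding g_def
      by (intro mult_left_mono) auto
    moreover have "(1 - r) ^ 2 * (9 / r ^ 2) = 9 * ((1 - r) / r) ^ 2"
      by (simp add: power_divide)
    moreover have "(1 - r) / r = L" using L by (simp add: r_def field_simps)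
    moreover have "L * 1 \<le> L * L" using L by (intro mult_left_mono) auto
    ultimately have "L \<le> L * L" "9 * (L * L) \<le> g r" by (simp_all add: power2_eq_square)
    then have "K < g r" using L by linarith
    then show ?thesis using r by blast
  qed
  have c_nonneg: "0 \<le> ?c r" if "r \<in> {0..1}" for r
    using that unfolding fun_cong[OF c_alt] by auto
  have step: "0 < xi_ratio (Suc j) \<and> xi_ratio (Suc j) < 1 \<and>
     (\<forall>r\<in>{0..1}. r \<noteq> xi_ratio (Suc j) \<longrightarrow> xi_min (Suc j) < xi r (xi_min j))"
    if pos: "0 < xi_min j" for j
  proof -
    obtain \<rho> where \<rho>: "0 < \<rho>" "\<rho> < 1"
      "\<And>r. r \<in> {0..1} \<Longrightarrow> r \<noteq> \<rho> \<Longrightarrow> xi \<rho> (xi_min j) < xi r (xi_min j)"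
      using unique_minimizer_power_plus[OF pos _ c c' g _ anti unbounded]
      by (force simp: xi_eq[of _ "xi_min j"] g_def)
    have "xi_ratio (Suc j) = \<rho>"
      unfolding xi_ratio_def using \<rho> by (intro arg_min_on_unique) auto
    moreover from this have "xi_min (Suc j) = xi \<rho> (xi_min j)"
      by (simp add: xi_ratio_def)
    ultimately show ?thesis using \<rho> by auto
  qed
  have "0 < xi_min j"
  proof (induction j)
    case (Suc j)
    have "xi_min (Suc j) = xi_min j * xi_ratio (Suc j) ^ 3 + ?c (xi_ratio (Suc j))"
      by (simp add: xi_ratio_def xi_eq[of _ "xi_min j"])
    moreover have "0 < xi_min j * xi_ratio (Suc j) ^ 3" using step[OF Suc] Suc by simp
    moreover have "0 \<le> ?c (xi_ratio (Suc j))" using step[OF Suc] by (intro c_nonneg) auto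
    ultimately show ?case by linarith
  qed simp
  with step[OF this] show ?thesis by blast
qed

section \<open>Integrals over the cells\<close>

lemma Ioc_integral_FTC:
  fixes F f :: "real \<Rightarrow> real"
  assumes ab: "a \<le> b" and F: "\<And>x. (F has_real_derivative f x) (at x)" and f: "continuous_on UNIV f"
  shows "set_integrable lborel {a<..b} f" and "(LINT x:{a<..b}|lborel. f x) = F b - F a"
proof -
  have "set_integrable lborel {a..b} f"
    by (intro borel_integrable_atLeastAtMost' continuous_on_subset[OF f]) auto
  then show "set_integrable lborel {a<..b} f" by (rule set_integrable_subset) auto
  have "(LINT x:{a<..b}|lborel. f x) = (LBINT x=a..b. f x)"
    using ab by (simp add: interval_integral_Ioc)
  also have "\<dots> = F b - F a"
    by (intro interval_integral_FTC_finite continuous_on_subset[OF f]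
        has_field_derivative_at_within[OF F, THEN has_real_derivative_iff_has_vector_derivative[THEN iffD1]]) auto
  finally show "(LINT x:{a<..b}|lborel. f x) = F b - F a" .
qed

lemma Ioc_integral_sum:
  fixes X :: "nat \<Rightarrow> real" and f :: "real \<Rightarrow> real"
  assumes "\<And>j. j < m \<Longrightarrow> X j \<le> X (Suc j)"
    and "\<And>j. j < m \<Longrightarrow> set_integrable lborel {X j<..X (Suc j)} f"
  shows "X 0 \<le> X m \<and> set_integrable lborel {X 0<..X m} f \<and>
    (LINT x:{X 0<..X m}|lborel. f x) = (\<Sum>j<m. LINT x:{X j<..X (Suc j)}|lborel. f x)"
  using assms
proof (induction m)
  case 0
  then show ?case by (simp add: set_integrable_def set_lebesgue_integral_def)
next
  case (Suc m)
  have IH: "X 0 \<le> X m" "set_integrable lborel {X 0<..X m} f"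
    "(LINT x:{X 0<..X m}|lborel. f x) = (\<Sum>j<m. LINT x:{X j<..X (Suc j)}|lborel. f x)"
    using Suc by auto
  have le: "X m \<le> X (Suc m)" using Suc.prems by auto
  have split: "{X 0<..X (Suc m)} = {X 0<..X m} \<union> {X m<..X (Suc m)}" using IH(1) le by auto
  show ?case
    using IH le Suc.prems unfolding split
    by (auto simp: set_integral_Un intro!: set_integrable_Un order_trans[OF IH(1) le])
qed

text \<open>
  Integrals over the symmetric interval reduce to the positive cells, as the origin is a null set.
\<close>

lemma integral_even:
  fixes f :: "real \<Rightarrow> real"
  assumes even: "\<And>x. f (- x) = f x" and int: "set_integrable lborel {0<..K} f" and K: "0 \<le> K"
    and f: "f \<in> borel_measurable borel"
  shows "(\<integral>x. indicator {-K..K} x * f x \<partial>lborel) = 2 * (LINT x:{0<..K}|lborel. f x)"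
proof -
  define g where "g x = indicator {0<..K} x * f x" for x
  have g: "integrable lborel g" using int by (simp add: set_integrable_def g_def[abs_def])
  have g': "integrable lborel (\<lambda>x. g (- x))"
    using lborel_integrable_real_affine[OF g, of "-1" 0] by simp
  have g'_int: "(\<integral>x. g (- x) \<partial>lborel) = (\<integral>x. g x \<partial>lborel)"
    using lborel_integral_real_affine[of "-1" g 0] by simp
  have eq: "AE x in lborel. g x + g (- x) = indicator {-K..K} x * f x"
    using AE_lborel_singleton[of 0]
    by eventually_elim (auto simp: g_def even indicator_def)
  have m: "(\<lambda>x. indicator {-K..K} x * f x) \<in> borel_measurable lborel" using f by measurable
  have "(\<integral>x. indicator {-K..K} x * f x \<partial>lborel) = (\<integral>x. g x + g (- x) \<partial>lborel)"
    using g g' m by (intro integral_cong_AE) (use eq in \<open>auto elim: eventually_mono\<close>)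
  also have "\<dots> = 2 * (\<integral>x. g x \<partial>lborel)" using g g' g'_int by simp
  finally show "(\<integral>x. indicator {-K..K} x * f x \<partial>lborel) = 2 * (LINT x:{0<..K}|lborel. f x)"
    by (simp add: set_lebesgue_integral_def g_def)
qed

text \<open>
  The mean of the density proportional to \<open>x\<close> on \<open>(a, b]\<close>. The orthogonality constraint on a cell
  determines the quantized value, and this is that value when the gain \<open>\<theta>\<close> is \<open>1\<close>.
\<close>

definition centroid :: "real \<Rightarrow> real \<Rightarrow> real" where
  "centroid a b = 2 * (a\<^sup>2 + a * b + b\<^sup>2) / (3 * (a + b))"

lemma cell_moment_zero_iff:
  assumes "0 \<le> a" "a < b"
  shows "(LINT x:{a<..b}|lborel. x * (v - \<theta> * x)) = 0 \<longleftrightarrow> v = \<theta> * centroid a b"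
proof -
  have "(LINT x:{a<..b}|lborel. x * (v - \<theta> * x)) =
      (v / 2 * b\<^sup>2 - \<theta> / 3 * b ^ 3) - (v / 2 * a\<^sup>2 - \<theta> / 3 * a ^ 3)"
  proof (rule Ioc_integral_FTC(2))
    show "((\<lambda>x. v / 2 * x\<^sup>2 - \<theta> / 3 * x ^ 3) has_real_derivative x * (v - \<theta> * x)) (at x)" for x
      by (rule derivative_eq_intros refl)+ (simp add: algebra_simps power2_eq_square)
  qed (use assms in \<open>auto intro!: continuous_intros\<close>)
  also have "\<dots> = (b - a) * (a + b) / 2 * (v - \<theta> * centroid a b)"
  proof -
    have "a + b \<noteq> 0" using assms by auto
    then show ?thesis unfolding centroid_def
      by (simp add: divide_simps) algebra
  qed
  finally show ?thesis using assms by auto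
qed

text \<open>
  The source of both one-step functions. With \<open>h = b - a\<close> and \<open>s = b + a\<close> the centroid is
  \<open>s / 2 + h\<^sup>2 / (6 * s)\<close>, and the squared error weighted by \<open>x\<^sup>2\<close> integrates to
  \<open>(- 18 * h ^ 5 + 45 * s\<^sup>2 * h ^ 3 + 5 * h ^ 7 / s\<^sup>2) / 2160\<close>, the unweighted one to
  \<open>(3 * h ^ 3 + h ^ 5 / s\<^sup>2) / 36\<close>, both up to the factor \<open>\<theta>\<^sup>2\<close>. The weight \<open>x\<^sup>2 + \<beta>\<close> is the shape of
  the conditional second moment of the rotated regressor given its leading component.
\<close>

lemma cell_error_integral:
  assumes ab: "0 \<le> a" "a < b" and v: "v = \<theta> * centroid a b"
  shows "set_integrable lborel {a<..b} (\<lambda>x. (x\<^sup>2 + \<beta>) * (v - \<theta> * x)\<^sup>2)"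
    and "(LINT x:{a<..b}|lborel. (x\<^sup>2 + \<beta>) * (v - \<theta> * x)\<^sup>2) =
      \<theta>\<^sup>2 * (b ^ 5 * psi (a / b) 0 / 2160 + \<beta> * (b ^ 3 * xi (a / b) 0) / 36)"
proof -
  define F where "F x = v\<^sup>2 / 3 * x ^ 3 - v * \<theta> / 2 * x ^ 4 + \<theta>\<^sup>2 / 5 * x ^ 5
    + \<beta> * (v\<^sup>2 * x - v * \<theta> * x\<^sup>2 + \<theta>\<^sup>2 / 3 * x ^ 3)" for x
  have F: "(F has_real_derivative (x\<^sup>2 + \<beta>) * (v - \<theta> * x)\<^sup>2) (at x)" for x
    unfolding F_def
    by (rule derivative_eq_intros refl)+ (simp, algebra)
  have cont: "continuous_on UNIV (\<lambda>x. (x\<^sup>2 + \<beta>) * (v - \<theta> * x)\<^sup>2)" by (intro continuous_intros)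
  show "set_integrable lborel {a<..b} (\<lambda>x. (x\<^sup>2 + \<beta>) * (v - \<theta> * x)\<^sup>2)"
    by (rule Ioc_integral_FTC(1)[OF _ F cont]) (use ab in simp)
  define h where "h = b - a"
  define s where "s = b + a"
  have s: "s \<noteq> 0" and b: "b \<noteq> 0" using ab by (auto simp: s_def)
  have ratio: "1 - a / b = h / b" "1 + a / b = s / b" using b by (auto simp: h_def s_def field_simps)
  have "b ^ 5 * psi (a / b) 0 = - 18 * h ^ 5 + 45 * s\<^sup>2 * h ^ 3 + 5 * h ^ 7 / s\<^sup>2"
    unfolding psi_def ratio using b s
    by (simp add: power_int_minus power_divide field_simps)
  moreover have "b ^ 3 * xi (a / b) 0 = 3 * h ^ 3 + h ^ 5 / s\<^sup>2"
    unfolding xi_def ratio using b s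
    by (simp add: power_divide field_simps)
  moreover have "F b - F a = \<theta>\<^sup>2 * ((- 18 * h ^ 5 + 45 * s\<^sup>2 * h ^ 3 + 5 * h ^ 7 / s\<^sup>2) / 2160
      + \<beta> * (3 * h ^ 3 + h ^ 5 / s\<^sup>2) / 36)"
  proof -
    have a: "a = (s - h) / 2" and b: "b = (s + h) / 2" by (auto simp: s_def h_def)
    have "centroid a b = s / 2 + h\<^sup>2 / (6 * s)"
      unfolding centroid_def a b using s by (simp add: divide_simps) algebra
    then have v': "v = \<theta> * (s / 2 + h\<^sup>2 / (6 * s))" by (simp add: v)
    show ?thesis
      unfolding F_def v' a b using s by (simp add: divide_simps) algebra
  qed
  moreover have "(LINT x:{a<..b}|lborel. (x\<^sup>2 + \<beta>) * (v - \<theta> * x)\<^sup>2) = F b - F a"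
    by (rule Ioc_integral_FTC(2)[OF _ F cont]) (use ab in simp)
  ultimately show "(LINT x:{a<..b}|lborel. (x\<^sup>2 + \<beta>) * (v - \<theta> * x)\<^sup>2) =
      \<theta>\<^sup>2 * (b ^ 5 * psi (a / b) 0 / 2160 + \<beta> * (b ^ 3 * xi (a / b) 0) / 36)"
    by simp
qed

lemma sum_cells_eq_nested_cost:
  fixes X :: "nat \<Rightarrow> real"
  assumes "X 0 = 0" and "\<And>j. j \<le> k \<Longrightarrow> 0 < X (Suc j)"
  shows "(\<Sum>j<Suc k. X (Suc j) ^ p * c (X j / X (Suc j)))
    = X (Suc k) ^ p * nested_cost p c k (\<lambda>j. X j / X (Suc j))"
  using assms(2)
proof (induction k)
  case 0
  then show ?case by (simp add: assms(1))
next
  case (Suc k)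
  have "X (Suc k) \<noteq> 0" "X (Suc (Suc k)) \<noteq> 0"
    using Suc.prems[of k] Suc.prems[of "Suc k"] by auto
  then show ?case
    using Suc by (simp add: algebra_simps power_divide)
qed

section \<open>Partitions and quantizers\<close>

text \<open>
  The explicit form of every quantizer (\<open>is_quantizerD\<close>), from which measurability and boundedness can be
  read off; it serves equally to construct quantizers with prescribed boundaries.
\<close>

definition odd_step :: "nat \<Rightarrow> (nat \<Rightarrow> real) \<Rightarrow> (nat \<Rightarrow> real) \<Rightarrow> real \<Rightarrow> real" where
  "odd_step m X v y =
    (\<Sum>j<m. v j * (indicator {X j<..X (Suc j)} y - indicator {X j<..X (Suc j)} (- y)))"

lemma partition_less:
  fixes X :: "nat \<Rightarrow> real"
  assumes "\<And>j. j < m \<Longrightarrow> X j < X (Suc j)" and "i < j" and "j \<le> m"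
  shows "X i < X j"
  using assms(2,3)
proof (induction j)
  case (Suc j)
  then show ?case using assms(1)[of j] by (cases "i = j") auto
qed simp

lemma partition_le:
  fixes X :: "nat \<Rightarrow> real"
  assumes "\<And>j. j < m \<Longrightarrow> X j < X (Suc j)" and "i \<le> j" and "j \<le> m"
  shows "X i \<le> X j"
  using partition_less[of m X i j, OF assms(1)] assms(2,3) by (cases "i = j") auto

lemma partition_cover:
  fixes X :: "nat \<Rightarrow> real"
  assumes "X 0 < y" and "y \<le> X m"
  shows "\<exists>j<m. y \<in> {X j<..X (Suc j)}"
  using assms(2)
proof (induction m)
  case 0
  then show ?case using assms(1) by simp
next
  case (Suc m)
  then show ?case by (cases "y \<le> X m") (auto simp: less_Suc_eq)
qed

lemma odd_step_minus: "odd_step m X v (- y) = - odd_step m X v y"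
  by (simp add: odd_step_def flip: sum_negf) (simp add: algebra_simps)

lemma odd_step_cell:
  fixes X :: "nat \<Rightarrow> real"
  assumes X: "X 0 = 0" "\<And>j. j < m \<Longrightarrow> X j < X (Suc j)" and j: "j < m" "y \<in> {X j<..X (Suc j)}"
  shows "odd_step m X v y = v j"
proof -
  have "0 \<le> X i" if "i \<le> m" for i using partition_le[of m X 0 i] X that by simp
  then have X_nonneg: "0 \<le> X i" if "i < m" for i using that by simp
  then have y0: "0 < y" using j by force
  have y: "\<not> X i < - y" if "i < m" for i using X_nonneg[OF that] y0 by simp
  have "indicator {X i<..X (Suc i)} y = (if i = j then 1 else 0 :: real)" if "i < m" for i
  proof (cases i j rule: linorder_cases)
    case less
    then have "X (Suc i) \<le> X j" using j by (intro partition_le[of m] X) auto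
    then show ?thesis using j less by auto
  next
    case greater
    then have "X (Suc j) \<le> X i" using that by (intro partition_le[of m] X) auto
    then show ?thesis using j greater by auto
  qed (use j in auto)
  then have "odd_step m X v y = (\<Sum>i<m. if i = j then v i else 0)"
    unfolding odd_step_def using y by (intro sum.cong) auto
  also have "\<dots> = v j" using j by (simp add: sum.delta)
  finally show ?thesis .
qed

lemma odd_step_outside:
  fixes X :: "nat \<Rightarrow> real"
  assumes X: "X 0 = 0" "\<And>j. j < m \<Longrightarrow> X j < X (Suc j)" and y: "X m < \<bar>y\<bar> \<or> y = 0"
  shows "odd_step m X v y = 0"
proof -
  have "0 \<le> X j \<and> X (Suc j) \<le> X m" if "j < m" for j
    using partition_le[of m X 0 j] partition_le[of m X "Suc j" m] X that by auto
  then have "indicator {X j<..X (Suc j)} y = (0::real) \<and> indicator {X j<..X (Suc j)} (- y) = (0::real)"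
    if "j < m" for j
    using y that by (fastforce simp: indicator_def)
  then show ?thesis by (auto simp: odd_step_def)
qed

lemma odd_step_measurable: "odd_step m X v \<in> borel_measurable borel"
  unfolding odd_step_def[abs_def] by measurable

lemma odd_step_bounded: "\<bar>odd_step m X v y\<bar> \<le> (\<Sum>j<m. \<bar>v j\<bar>)"
proof -
  have "\<bar>odd_step m X v y\<bar> \<le> (\<Sum>j<m. \<bar>v j * (indicator {X j<..X (Suc j)} y - indicator {X j<..X (Suc j)} (- y))\<bar>)"
    unfolding odd_step_def by (rule sum_abs)
  also have "\<dots> \<le> (\<Sum>j<m. \<bar>v j\<bar>)"
    by (intro sum_mono) (auto simp: abs_mult indicator_def)
  finally show ?thesis .
qed

lemma is_quantizerD:
  assumes "is_quantizer m K d q"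
  shows "d 0 = 0" and "d (int m) = K" and "\<And>j. j < m \<Longrightarrow> d (int j) < d (int (Suc j))"
    and "\<exists>v. q = odd_step m (\<lambda>j. d (int j)) v"
proof -
  show d0: "d 0 = 0" and dm: "d (int m) = K" using assms by (auto simp: is_quantizer_def)
  show inc: "d (int j) < d (int (Suc j))" if "j < m" for j
    using assms that by (auto simp: is_quantizer_def add.commute)
  obtain v where v: "\<And>j y. j \<in> {- int m..int m} \<Longrightarrow> y \<in> cell d j \<Longrightarrow> q y = v j"
    using assms by (auto simp: is_quantizer_def)
  have odd: "q (- y) = - q y" for y using assms by (auto simp: is_quantizer_def)
  have out: "q y = 0" if "K < \<bar>y\<bar>" for y using assms that by (auto simp: is_quantizer_def)
  define X where "X j = d (int j)" for j
  define w where "w j = v (int (Suc j))" for j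
  have X: "X 0 = 0" "\<And>j. j < m \<Longrightarrow> X j < X (Suc j)" using d0 inc by (auto simp: X_def)
  have pos: "q y = odd_step m X w y" if y: "0 \<le> y" for y
  proof -
    consider "y = 0" | "K < y" | "0 < y" "y \<le> K" using y by linarith
    then show ?thesis
    proof cases
      case 1
      then show ?thesis using odd[of 0] odd_step_outside[of X m y w, OF X] by simp
    next
      case 2
      then show ?thesis using odd_step_outside[of X m y w, OF X] out[of y] y by (simp add: X_def dm)
    next
      case 3
      then obtain j where j: "j < m" "y \<in> {X j<..X (Suc j)}"
        using partition_cover[where X = X and y = y and m = m] by (auto simp: X_def d0 dm)
      have "y \<in> cell d (int (Suc j))" using j by (auto simp: cell_def X_def)
      then have "q y = w j" using v[of "int (Suc j)" y] j by (auto simp: w_def)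
      then show ?thesis using odd_step_cell[of X m j y w, OF X j] by simp
    qed
  qed
  have "q y = odd_step m X w y" for y
    using pos[of y] pos[of "- y"] odd[of y] odd_step_minus[of m X w y] by (cases "0 \<le> y") auto
  then show "\<exists>v. q = odd_step m (\<lambda>j. d (int j)) v" by (auto simp: X_def[abs_def])
qed

section \<open>Moments of the uniform distribution on the cube\<close>

definition unif_pdf :: "real \<Rightarrow> real \<Rightarrow> real" where
  "unif_pdf \<kappa> x = indicator {-\<kappa>..\<kappa>} x / (2 * \<kappa>)"

lemma unif_pdf_measurable [measurable]: "unif_pdf \<kappa> \<in> borel_measurable borel"
  unfolding unif_pdf_def[abs_def] by measurable

lemma integrable_unif_pdf:
  assumes [measurable]: "f \<in> borel_measurable borel" and B: "\<And>x. x \<in> {-\<kappa>..\<kappa>} \<Longrightarrow> \<bar>f x\<bar> \<le> B"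
  shows "integrable lborel (\<lambda>x. unif_pdf \<kappa> x * f x)"
proof -
  have "integrable lborel (\<lambda>x. indicator {-\<kappa>..\<kappa>} x *\<^sub>R (f x / (2 * \<kappa>)))"
    by (rule integrableI_bounded_set_indicator[where B = "B / \<bar>2 * \<kappa>\<bar>"])
      (use B in \<open>auto simp: emeasure_lborel_Icc_eq intro!: divide_right_mono\<close>)
  then show ?thesis by (simp add: unif_pdf_def)
qed

lemma unif_pdf_moments:
  assumes \<kappa>: "0 < \<kappa>"
  shows "integrable lborel (unif_pdf \<kappa>)" and "(\<integral>x. unif_pdf \<kappa> x \<partial>lborel) = 1"
    and "(\<integral>x. unif_pdf \<kappa> x * x \<partial>lborel) = 0"
    and "(\<integral>x. unif_pdf \<kappa> x * x\<^sup>2 \<partial>lborel) = \<kappa>\<^sup>2 / 3"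
proof -
  show "integrable lborel (unif_pdf \<kappa>)"
    using integrable_unif_pdf[of "\<lambda>_. 1" \<kappa> 1] by simp
  have "(\<integral>x. unif_pdf \<kappa> x \<partial>lborel) = (LINT x:{-\<kappa>..\<kappa>}|lborel. 1 / (2 * \<kappa>))"
    by (simp add: unif_pdf_def set_lebesgue_integral_def)
  also have "\<dots> = 1" using \<kappa> by (simp add: set_integral_const)
  finally show "(\<integral>x. unif_pdf \<kappa> x \<partial>lborel) = 1" .
  have "(\<integral>x. unif_pdf \<kappa> x * x \<partial>lborel) = - (\<integral>x. unif_pdf \<kappa> x * x \<partial>lborel)"
    using lborel_integral_real_affine[of "-1" "\<lambda>x. unif_pdf \<kappa> x * x" 0]
    by (simp add: unif_pdf_def indicator_def conj_commute minus_le_iff le_minus_iff flip: Bochner_Integration.integral_minus)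
  then show "(\<integral>x. unif_pdf \<kappa> x * x \<partial>lborel) = 0" by simp
  have "(LINT x:{0<..\<kappa>}|lborel. x\<^sup>2) = (1 / 3) * \<kappa> ^ 3 - (1 / 3) * 0 ^ 3"
    by (rule Ioc_integral_FTC) (use \<kappa> in \<open>auto intro!: derivative_eq_intros continuous_intros\<close>)
  moreover have "(\<integral>x. indicator {-\<kappa>..\<kappa>} x * x\<^sup>2 \<partial>lborel) = 2 * (LINT x:{0<..\<kappa>}|lborel. x\<^sup>2)"
    by (rule integral_even) (use \<kappa> in \<open>auto intro!: Ioc_integral_FTC(1)[where F = "\<lambda>x. 1 / 3 * x ^ 3"]
        derivative_eq_intros continuous_intros\<close>)
  ultimately have "(\<integral>x. indicator {-\<kappa>..\<kappa>} x * x\<^sup>2 \<partial>lborel) = 2 * \<kappa> ^ 3 / 3" by simp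
  moreover have "(\<integral>x. unif_pdf \<kappa> x * x\<^sup>2 \<partial>lborel) = (\<integral>x. indicator {-\<kappa>..\<kappa>} x * x\<^sup>2 \<partial>lborel) / (2 * \<kappa>)"
    unfolding unif_pdf_def by (simp flip: integral_divide_zero)
  ultimately show "(\<integral>x. unif_pdf \<kappa> x * x\<^sup>2 \<partial>lborel) = \<kappa>\<^sup>2 / 3"
    using \<kappa> by (simp add: power2_eq_square power3_eq_cube)
qed

lemma unif_density_eq_prod:
  assumes "z \<in> extensional {..<n}"
  shows "unif_density n \<kappa> z = (\<Prod>i<n. unif_pdf \<kappa> (z i))"
proof -
  have "indicator (PiE {..<n} (\<lambda>_. {-\<kappa>..\<kappa>})) z = (\<Prod>i<n. indicator {-\<kappa>..\<kappa>} (z i) :: real)"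
  proof (cases "z \<in> PiE {..<n} (\<lambda>_. {-\<kappa>..\<kappa>})")
    case True
    then show ?thesis by (auto simp: PiE_iff intro!: prod.neutral[symmetric])
  next
    case False
    then obtain i where "i < n" "z i \<notin> {-\<kappa>..\<kappa>}" using assms by (auto simp: PiE_iff)
    then have "(\<Prod>i<n. indicator {-\<kappa>..\<kappa>} (z i) :: real) = 0" by (intro prod_zero bexI[of _ i]) auto
    then show ?thesis using False by simp
  qed
  then show ?thesis by (simp add: unif_density_def unif_pdf_def prod_dividef)
qed

text \<open>
  Under the uniform distribution on the cube the coordinates are independent, so expectations of products
  of functions of single coordinates factor. The next two lemmas are the cases in which all but one
  or two of the functions are \<open>1\<close>.
\<close>

lemma uniform_cube_product:
  fixes h :: "'i \<Rightarrow> real \<Rightarrow> real"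
  assumes I: "finite I" and h: "\<And>i. i \<in> I \<Longrightarrow> integrable lborel (\<lambda>x. unif_pdf \<kappa> x * h i x)"
  shows "integrable (PiM I (\<lambda>_. lborel)) (\<lambda>z. (\<Prod>i\<in>I. unif_pdf \<kappa> (z i)) * (\<Prod>i\<in>I. h i (z i)))"
    and "(\<integral>z. (\<Prod>i\<in>I. unif_pdf \<kappa> (z i)) * (\<Prod>i\<in>I. h i (z i)) \<partial>PiM I (\<lambda>_. lborel)) =
      (\<Prod>i\<in>I. \<integral>x. unif_pdf \<kappa> x * h i x \<partial>lborel)"
proof -
  interpret product_sigma_finite "\<lambda>_::'i. lborel :: real measure" ..
  show "integrable (PiM I (\<lambda>_. lborel)) (\<lambda>z. (\<Prod>i\<in>I. unif_pdf \<kappa> (z i)) * (\<Prod>i\<in>I. h i (z i)))"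
    using product_integrable_prod[OF I h] by (simp add: prod.distrib)
  show "(\<integral>z. (\<Prod>i\<in>I. unif_pdf \<kappa> (z i)) * (\<Prod>i\<in>I. h i (z i)) \<partial>PiM I (\<lambda>_. lborel)) =
      (\<Prod>i\<in>I. \<integral>x. unif_pdf \<kappa> x * h i x \<partial>lborel)"
    using product_integral_prod[OF I h] by (simp add: prod.distrib)
qed

lemma uniform_cube_coordinate:
  fixes h :: "real \<Rightarrow> real"
  assumes \<kappa>: "0 < \<kappa>" and I: "finite I" "k \<in> I" and h: "integrable lborel (\<lambda>x. unif_pdf \<kappa> x * h x)"
  shows "integrable (PiM I (\<lambda>_. lborel)) (\<lambda>z. (\<Prod>i\<in>I. unif_pdf \<kappa> (z i)) * h (z k))"
    and "(\<integral>z. (\<Prod>i\<in>I. unif_pdf \<kappa> (z i)) * h (z k) \<partial>PiM I (\<lambda>_. lborel)) =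
      (\<integral>x. unif_pdf \<kappa> x * h x \<partial>lborel)"
proof -
  define H where "H i = (if i = k then h else (\<lambda>_. 1))" for i
  have H: "integrable lborel (\<lambda>x. unif_pdf \<kappa> x * H i x)" for i
    using h unif_pdf_moments(1)[OF \<kappa>] by (simp add: H_def)
  have prod: "(\<Prod>i\<in>I. H i (z i)) = h (z k)" for z
    using I by (simp add: H_def prod.remove[of I k] if_distrib[of "\<lambda>f. f _"] cong: if_cong)
  have integrals: "(\<integral>x. unif_pdf \<kappa> x * H i x \<partial>lborel) = (if i = k then \<integral>x. unif_pdf \<kappa> x * h x \<partial>lborel else 1)" for i
    using unif_pdf_moments(2)[OF \<kappa>] by (simp add: H_def)
  show "integrable (PiM I (\<lambda>_. lborel)) (\<lambda>z. (\<Prod>i\<in>I. unif_pdf \<kappa> (z i)) * h (z k))"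
    using uniform_cube_product(1)[of I \<kappa> H, OF I(1) H] by (simp add: prod)
  show "(\<integral>z. (\<Prod>i\<in>I. unif_pdf \<kappa> (z i)) * h (z k) \<partial>PiM I (\<lambda>_. lborel)) =
      (\<integral>x. unif_pdf \<kappa> x * h x \<partial>lborel)"
    using uniform_cube_product(2)[of I \<kappa> H, OF I(1) H] I by (simp add: prod integrals)
qed

lemma uniform_cube_two_coordinates:
  fixes g h :: "real \<Rightarrow> real"
  assumes \<kappa>: "0 < \<kappa>" and I: "finite I" "k \<in> I" "l \<in> I" "k \<noteq> l"
    and h: "integrable lborel (\<lambda>x. unif_pdf \<kappa> x * h x)" and g: "integrable lborel (\<lambda>x. unif_pdf \<kappa> x * g x)"
  shows "integrable (PiM I (\<lambda>_. lborel)) (\<lambda>z. (\<Prod>i\<in>I. unif_pdf \<kappa> (z i)) * (h (z k) * g (z l)))"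
    and "(\<integral>z. (\<Prod>i\<in>I. unif_pdf \<kappa> (z i)) * (h (z k) * g (z l)) \<partial>PiM I (\<lambda>_. lborel)) =
      (\<integral>x. unif_pdf \<kappa> x * h x \<partial>lborel) * (\<integral>x. unif_pdf \<kappa> x * g x \<partial>lborel)"
proof -
  define H where "H i = (if i = k then h else if i = l then g else (\<lambda>_. 1))" for i
  have H: "integrable lborel (\<lambda>x. unif_pdf \<kappa> x * H i x)" for i
    using h g unif_pdf_moments(1)[OF \<kappa>] by (simp add: H_def)
  have split: "prod f I = f k * (f l * prod f (I - {k} - {l}))" for f :: "_ \<Rightarrow> real"
    using I by (subst prod.remove[of I k], simp, simp, subst prod.remove[of "I - {k}" l]) auto
  have prod: "(\<Prod>i\<in>I. H i (z i)) = h (z k) * g (z l)" for z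
    using I by (subst split) (auto simp: H_def intro!: prod.neutral)
  have integrals: "(\<Prod>i\<in>I. \<integral>x. unif_pdf \<kappa> x * H i x \<partial>lborel) =
      (\<integral>x. unif_pdf \<kappa> x * h x \<partial>lborel) * (\<integral>x. unif_pdf \<kappa> x * g x \<partial>lborel)"
    using I unif_pdf_moments(2)[OF \<kappa>] by (subst split) (auto simp: H_def intro!: prod.neutral)
  show "integrable (PiM I (\<lambda>_. lborel)) (\<lambda>z. (\<Prod>i\<in>I. unif_pdf \<kappa> (z i)) * (h (z k) * g (z l)))"
    using uniform_cube_product(1)[of I \<kappa> H, OF I(1) H] by (simp add: prod)
  show "(\<integral>z. (\<Prod>i\<in>I. unif_pdf \<kappa> (z i)) * (h (z k) * g (z l)) \<partial>PiM I (\<lambda>_. lborel)) =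
      (\<integral>x. unif_pdf \<kappa> x * h x \<partial>lborel) * (\<integral>x. unif_pdf \<kappa> x * g x \<partial>lborel)"
    using uniform_cube_product(2)[of I \<kappa> H, OF I(1) H] by (simp add: prod integrals)
qed

lemma unif_density_fix_leading:
  assumes "1 \<le> n" and z: "z \<in> space (PiM {1..<n} (\<lambda>_. lborel))"
  shows "unif_density n \<kappa> (z(0 := x)) = unif_pdf \<kappa> x * (\<Prod>i\<in>{1..<n}. unif_pdf \<kappa> (z i))"
proof -
  have "z(0 := x) \<in> extensional {..<n}"
    using z assms(1) by (auto simp: space_PiM PiE_def extensional_def)
  then have "unif_density n \<kappa> (z(0 := x)) = (\<Prod>i<n. unif_pdf \<kappa> ((z(0 := x)) i))"
    by (rule unif_density_eq_prod)
  also have "{..<n} = insert 0 {1..<n}" using assms(1) by auto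
  also have "(\<Prod>i\<in>insert 0 {1..<n}. unif_pdf \<kappa> ((z(0 := x)) i)) = unif_pdf \<kappa> x * (\<Prod>i\<in>{1..<n}. unif_pdf \<kappa> (z i))"
    by simp
  finally show ?thesis .
qed

lemma marg_density_eq:
  assumes n: "1 \<le> n" and \<kappa>: "0 < \<kappa>"
  shows "marg_density n \<kappa> x = unif_pdf \<kappa> x"
proof -
  have "(\<integral>z. unif_density n \<kappa> (z(0 := x)) \<partial>PiM {1..<n} (\<lambda>_. lborel)) =
      (\<integral>z. unif_pdf \<kappa> x * ((\<Prod>i\<in>{1..<n}. unif_pdf \<kappa> (z i)) * (\<Prod>i\<in>{1..<n}. 1)) \<partial>PiM {1..<n} (\<lambda>_. lborel))"
    by (intro Bochner_Integration.integral_cong refl) (subst unif_density_fix_leading[OF n], assumption, simp)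
  also have "\<dots> = unif_pdf \<kappa> x"
    using uniform_cube_product(2)[of "{1..<n}" \<kappa> "\<lambda>_ _. 1"] unif_pdf_moments[OF \<kappa>] by simp
  finally show ?thesis by (simp add: marg_density_def)
qed

text \<open>
  The leading component contributes \<open>x\<^sup>2\<close> and each of the other \<open>n - 1\<close> components its variance
  \<open>\<kappa>\<^sup>2 / 3\<close>. Outside \<open>[-\<kappa>, \<kappa>]\<close> the marginal density vanishes and both sides are \<open>0\<close>.
\<close>

lemma sigma_sq_marg_density:
  assumes n: "1 \<le> n" and \<kappa>: "0 < \<kappa>"
  shows "sigma_sq n \<kappa> x * marg_density n \<kappa> x = unif_pdf \<kappa> x * (x\<^sup>2 + (real n - 1) * \<kappa>\<^sup>2 / 3)"
proof -
  define W where "W z = (\<Prod>i\<in>{1..<n}. unif_pdf \<kappa> (z i))" for z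
  have sq: "integrable lborel (\<lambda>x. unif_pdf \<kappa> x * x\<^sup>2)"
    by (rule integrable_unif_pdf[where B = "\<kappa>\<^sup>2"]) (auto simp: abs_le_square_iff[symmetric])
  have W: "integrable (PiM {1..<n} (\<lambda>_. lborel)) W" "(\<integral>z. W z \<partial>PiM {1..<n} (\<lambda>_. lborel)) = 1"
    using uniform_cube_product[of "{1..<n}" \<kappa> "\<lambda>_ _. 1"] unif_pdf_moments[OF \<kappa>] by (simp_all add: W_def[abs_def])
  have Wk: "integrable (PiM {1..<n} (\<lambda>_. lborel)) (\<lambda>z. W z * (z k)\<^sup>2)"
    "(\<integral>z. W z * (z k)\<^sup>2 \<partial>PiM {1..<n} (\<lambda>_. lborel)) = \<kappa>\<^sup>2 / 3" if "k \<in> {1..<n}" for k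
    using uniform_cube_coordinate[OF \<kappa> _ that sq] unif_pdf_moments[OF \<kappa>] by (simp_all add: W_def)
  have split: "{..<n} = insert 0 {1..<n}" using n by auto
  have "(\<integral>z. (\<Sum>k<n. ((z(0 := x)) k)\<^sup>2) * unif_density n \<kappa> (z(0 := x)) \<partial>PiM {1..<n} (\<lambda>_. lborel)) =
     (\<integral>z. unif_pdf \<kappa> x * (x\<^sup>2 * W z + (\<Sum>k\<in>{1..<n}. W z * (z k)\<^sup>2)) \<partial>PiM {1..<n} (\<lambda>_. lborel))"
  proof (intro Bochner_Integration.integral_cong refl)
    fix z :: "nat \<Rightarrow> real" assume z: "z \<in> space (PiM {1..<n} (\<lambda>_. lborel))"
    have "(\<Sum>k<n. ((z(0 := x)) k)\<^sup>2) = x\<^sup>2 + (\<Sum>k\<in>{1..<n}. (z k)\<^sup>2)"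
      unfolding split by simp
    then show "(\<Sum>k<n. ((z(0 := x)) k)\<^sup>2) * unif_density n \<kappa> (z(0 := x)) =
        unif_pdf \<kappa> x * (x\<^sup>2 * W z + (\<Sum>k\<in>{1..<n}. W z * (z k)\<^sup>2))"
      unfolding unif_density_fix_leading[OF n z] W_def
      by (simp add: algebra_simps sum_distrib_left)
  qed
  also have "\<dots> = unif_pdf \<kappa> x * (x\<^sup>2 + (real n - 1) * \<kappa>\<^sup>2 / 3)"
  proof -
    have "(\<integral>z. (\<Sum>k\<in>{1..<n}. W z * (z k)\<^sup>2) \<partial>PiM {1..<n} (\<lambda>_. lborel)) = (\<Sum>k\<in>{1..<n}. \<kappa>\<^sup>2 / 3)"
      by (rule trans[OF Bochner_Integration.integral_sum[OF Wk(1)] sum.cong[OF refl Wk(2)]])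
    then have "(\<integral>z. x\<^sup>2 * W z + (\<Sum>k\<in>{1..<n}. W z * (z k)\<^sup>2) \<partial>PiM {1..<n} (\<lambda>_. lborel))
        = x\<^sup>2 + (real n - 1) * \<kappa>\<^sup>2 / 3"
      using W Wk n
      by (subst Bochner_Integration.integral_add)
        (auto simp: of_nat_diff intro!: Bochner_Integration.integrable_sum)
    then show ?thesis by simp
  qed
  finally show ?thesis
    using \<kappa> by (simp add: sigma_sq_def marg_density_eq[OF n \<kappa>]) (simp add: unif_pdf_def indicator_def)
qed

section \<open>The objective as a one-dimensional integral\<close>

lemma fir_modelD:
  assumes "fir_model n N \<kappa> \<theta>1 P u T \<theta>"
  shows "1 \<le> n" "prob_space P" "\<And>t. u t \<in> borel_measurable P" "orthogonal_mat n T"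
    "\<And>k. k < n \<Longrightarrow> (\<Sum>i<n. T i k * \<theta> i) = (if k = 0 then \<theta>1 else 0)"
    "\<And>t. t \<in> {1..N} \<Longrightarrow> distributed P (PiM {..<n} (\<lambda>_. lborel))
        (\<lambda>\<omega>. \<lambda>k\<in>{..<n}. rot_regressor n u T \<omega> t k) (\<lambda>x. ennreal (unif_density n \<kappa> x))"
  using assms by (auto simp: fir_model_def)

lemma rot_regressor_measurable:
  assumes "fir_model n N \<kappa> \<theta>1 P u T \<theta>"
  shows "(\<lambda>\<omega>. rot_regressor n u T \<omega> t k) \<in> borel_measurable P"
  unfolding rot_regressor_def regressor_def
  using fir_modelD(3)[OF assms] by measurable

text \<open>
  Since \<open>T\<close> is orthogonal, the assumption on its transpose times \<open>\<theta>\<close> says that \<open>\<theta>\<close> is \<open>\<theta>1\<close> times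
  the leading column of \<open>T\<close>.
\<close>

lemma noiseless_output_eq:
  assumes "fir_model n N \<kappa> \<theta>1 P u T \<theta>"
  shows "noiseless_output n u \<theta> \<omega> t = \<theta>1 * rot_regressor n u T \<omega> t 0"
proof -
  note m = fir_modelD[OF assms]
  have \<theta>: "\<theta> i = \<theta>1 * T i 0" if i: "i < n" for i
  proof -
    have "(\<Sum>k<n. T i k * (\<Sum>j<n. T j k * \<theta> j)) = (\<Sum>j<n. (\<Sum>k<n. T i k * T j k) * \<theta> j)"
      unfolding sum_distrib_left sum_distrib_right by (subst sum.swap) (simp add: mult.assoc)
    also have "\<dots> = (\<Sum>j<n. if i = j then \<theta> j else 0)"
      using m(4) i by (intro sum.cong) (auto simp: orthogonal_mat_def)
    also have "\<dots> = \<theta> i" using i by simp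
    finally have "\<theta> i = (\<Sum>k<n. T i k * (if k = 0 then \<theta>1 else 0))" using m(5) by simp
    also have "\<dots> = (\<Sum>k<n. if k = 0 then T i 0 * \<theta>1 else 0)" by (intro sum.cong) auto
    also have "\<dots> = \<theta>1 * T i 0" using m(1) by simp
    finally show ?thesis .
  qed
  show ?thesis
    unfolding noiseless_output_def rot_regressor_def sum_distrib_left
    by (intro sum.cong) (auto simp: \<theta>)
qed

lemma quant_error_eq:
  assumes "fir_model n N \<kappa> \<theta>1 P u T \<theta>"
  shows "quant_error n u \<theta> q \<omega> t = err_fun \<theta>1 q (rot_regressor n u T \<omega> t 0)"
  by (simp add: quant_error_def err_fun_def noiseless_output_eq[OF assms])

lemma orthogonal_sum_sq:
  assumes T: "orthogonal_mat n T"
  shows "(\<Sum>k<n. (\<Sum>i<n. a i * T i k)\<^sup>2) = (\<Sum>i<n. (a i)\<^sup>2)"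
proof -
  have "(\<Sum>k<n. (\<Sum>i<n. a i * T i k)\<^sup>2) = (\<Sum>k<n. \<Sum>i<n. \<Sum>j<n. a i * a j * (T i k * T j k))"
    by (intro sum.cong refl) (simp add: power2_eq_square sum_product algebra_simps)
  also have "\<dots> = (\<Sum>i<n. \<Sum>k<n. \<Sum>j<n. a i * a j * (T i k * T j k))" by (rule sum.swap)
  also have "\<dots> = (\<Sum>i<n. \<Sum>j<n. \<Sum>k<n. a i * a j * (T i k * T j k))"
    by (intro sum.cong refl sum.swap)
  also have "\<dots> = (\<Sum>i<n. \<Sum>j<n. a i * a j * (\<Sum>k<n. T i k * T j k))"
    by (simp add: sum_distrib_left)
  also have "\<dots> = (\<Sum>i<n. \<Sum>j<n. if i = j then a i * a j else 0)"
    using T by (intro sum.cong refl) (auto simp: orthogonal_mat_def)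
  also have "\<dots> = (\<Sum>i<n. (a i)\<^sup>2)" by (simp add: power2_eq_square)
  finally show ?thesis .
qed

text \<open>
  Rotating the regressors rotates the vector whose norm is taken, hence the equality holds pointwise.
\<close>

lemma V_UE_eq_V_rot_UE:
  assumes "fir_model n N \<kappa> \<theta>1 P u T \<theta>"
  shows "V_UE n N P u \<theta> q = V_rot_UE n N P u T \<theta> q"
proof -
  have "(\<Sum>k<n. (transpose_mult N (rot_regressor n u T \<omega>) e k)\<^sup>2)
      = (\<Sum>k<n. (transpose_mult N (regressor u \<omega>) e k)\<^sup>2)" for \<omega> e
  proof -
    have "transpose_mult N (rot_regressor n u T \<omega>) e k
        = (\<Sum>i<n. transpose_mult N (regressor u \<omega>) e i * T i k)" for k
      unfolding transpose_mult_def rot_regressor_def sum_distrib_right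
      by (subst sum.swap) (simp add: algebra_simps)
    then show ?thesis using orthogonal_sum_sq[OF fir_modelD(4)[OF assms]] by simp
  qed
  then show ?thesis by (simp add: V_UE_def V_rot_UE_def mean_sq_norm_def)
qed

lemma expectation_leading:
  assumes fir: "fir_model n N \<kappa> \<theta>1 P u T \<theta>" and \<kappa>: "0 < \<kappa>" and t: "t \<in> {1..N}"
    and h [measurable]: "h \<in> borel_measurable borel" and int: "integrable lborel (\<lambda>x. unif_pdf \<kappa> x * h x)"
  shows "integrable P (\<lambda>\<omega>. h (rot_regressor n u T \<omega> t 0))"
    and "(\<integral>\<omega>. h (rot_regressor n u T \<omega> t 0) \<partial>P) = (\<integral>x. unif_pdf \<kappa> x * h x \<partial>lborel)"
proof -
  note m = fir_modelD[OF fir]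
  have 0: "0 \<in> {..<n}" using m(1) by simp
  have dens: "unif_density n \<kappa> z * h (z 0) = (\<Prod>i<n. unif_pdf \<kappa> (z i)) * h (z 0)"
    if "z \<in> space (PiM {..<n} (\<lambda>_. lborel))" for z
    using that by (subst unif_density_eq_prod) (auto simp: space_PiM PiE_def)
  have meas: "(\<lambda>z. h (z 0)) \<in> borel_measurable (PiM {..<n} (\<lambda>_. lborel))"
    using 0 by measurable
  have nn: "0 \<le> unif_density n \<kappa> z" for z using \<kappa> by (simp add: unif_density_def)
  have "integrable (PiM {..<n} (\<lambda>_. lborel)) (\<lambda>z. unif_density n \<kappa> z * h (z 0))"
    using uniform_cube_coordinate(1)[OF \<kappa> _ 0 int] by (subst Bochner_Integration.integrable_cong[OF refl dens]) auto
  then show "integrable P (\<lambda>\<omega>. h (rot_regressor n u T \<omega> t 0))"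
    using distributed_integrable[OF m(6)[OF t] meas nn] 0 by simp
  have "(\<integral>z. unif_density n \<kappa> z * h (z 0) \<partial>PiM {..<n} (\<lambda>_. lborel)) = (\<integral>x. unif_pdf \<kappa> x * h x \<partial>lborel)"
    using uniform_cube_coordinate(2)[OF \<kappa> _ 0 int] by (subst Bochner_Integration.integral_cong[OF refl dens]) auto
  then show "(\<integral>\<omega>. h (rot_regressor n u T \<omega> t 0) \<partial>P) = (\<integral>x. unif_pdf \<kappa> x * h x \<partial>lborel)"
    using distributed_integral[OF m(6)[OF t] meas nn] 0 by simp
qed

lemma expectation_pair:
  assumes fir: "fir_model n N \<kappa> \<theta>1 P u T \<theta>" and \<kappa>: "0 < \<kappa>" and t: "t \<in> {1..N}" and k: "0 < k" "k < n"
    and h [measurable]: "h \<in> borel_measurable borel" and int_h: "integrable lborel (\<lambda>x. unif_pdf \<kappa> x * h x)"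
    and g [measurable]: "g \<in> borel_measurable borel" and int_g: "integrable lborel (\<lambda>x. unif_pdf \<kappa> x * g x)"
  shows "integrable P (\<lambda>\<omega>. h (rot_regressor n u T \<omega> t k) * g (rot_regressor n u T \<omega> t 0))"
    and "(\<integral>\<omega>. h (rot_regressor n u T \<omega> t k) * g (rot_regressor n u T \<omega> t 0) \<partial>P) =
      (\<integral>x. unif_pdf \<kappa> x * h x \<partial>lborel) * (\<integral>x. unif_pdf \<kappa> x * g x \<partial>lborel)"
proof -
  note m = fir_modelD[OF fir]
  have 0: "k \<in> {..<n}" "0 \<in> {..<n}" "k \<noteq> 0" using k by auto
  have dens: "unif_density n \<kappa> z * (h (z k) * g (z 0)) = (\<Prod>i<n. unif_pdf \<kappa> (z i)) * (h (z k) * g (z 0))"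
    if "z \<in> space (PiM {..<n} (\<lambda>_. lborel))" for z
    using that by (subst unif_density_eq_prod) (auto simp: space_PiM PiE_def)
  have meas: "(\<lambda>z. h (z k) * g (z 0)) \<in> borel_measurable (PiM {..<n} (\<lambda>_. lborel))"
    using 0 by measurable
  have nn: "0 \<le> unif_density n \<kappa> z" for z using \<kappa> by (simp add: unif_density_def)
  have "integrable (PiM {..<n} (\<lambda>_. lborel)) (\<lambda>z. unif_density n \<kappa> z * (h (z k) * g (z 0)))"
    using uniform_cube_two_coordinates(1)[OF \<kappa> _ 0 int_h int_g]
    by (subst Bochner_Integration.integrable_cong[OF refl dens]) auto
  then show "integrable P (\<lambda>\<omega>. h (rot_regressor n u T \<omega> t k) * g (rot_regressor n u T \<omega> t 0))"
    using distributed_integrable[OF m(6)[OF t] meas nn] 0 by simp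
  have "(\<integral>z. unif_density n \<kappa> z * (h (z k) * g (z 0)) \<partial>PiM {..<n} (\<lambda>_. lborel)) =
      (\<integral>x. unif_pdf \<kappa> x * h x \<partial>lborel) * (\<integral>x. unif_pdf \<kappa> x * g x \<partial>lborel)"
    using uniform_cube_two_coordinates(2)[OF \<kappa> _ 0 int_h int_g]
    by (subst Bochner_Integration.integral_cong[OF refl dens]) auto
  then show "(\<integral>\<omega>. h (rot_regressor n u T \<omega> t k) * g (rot_regressor n u T \<omega> t 0) \<partial>P) =
      (\<integral>x. unif_pdf \<kappa> x * h x \<partial>lborel) * (\<integral>x. unif_pdf \<kappa> x * g x \<partial>lborel)"
    using distributed_integral[OF m(6)[OF t] meas nn] 0 by simp
qed

lemma integrable_mult_of_squares:
  fixes f g :: "'a \<Rightarrow> real"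
  assumes [measurable]: "f \<in> borel_measurable P" "g \<in> borel_measurable P"
    and "integrable P (\<lambda>x. (f x)\<^sup>2)" "integrable P (\<lambda>x. (g x)\<^sup>2)"
  shows "integrable P (\<lambda>x. f x * g x)"
proof (rule Bochner_Integration.integrable_bound)
  show "integrable P (\<lambda>x. (f x)\<^sup>2 + (g x)\<^sup>2)" using assms by simp
  show "AE x in P. norm (f x * g x) \<le> norm ((f x)\<^sup>2 + (g x)\<^sup>2)"
  proof (intro AE_I2)
    fix x
    have "2 * \<bar>f x\<bar> * \<bar>g x\<bar> \<le> (f x)\<^sup>2 + (g x)\<^sup>2"
      using sum_squares_bound[of "\<bar>f x\<bar>" "\<bar>g x\<bar>"] by simp
    moreover have "0 \<le> \<bar>f x\<bar> * \<bar>g x\<bar>" by simp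
    ultimately have "\<bar>f x\<bar> * \<bar>g x\<bar> \<le> (f x)\<^sup>2 + (g x)\<^sup>2" unfolding mult.assoc by linarith
    then show "norm (f x * g x) \<le> norm ((f x)\<^sup>2 + (g x)\<^sup>2)" by (simp add: abs_mult)
  qed
qed simp

text \<open>
  The theorem of Pythagoras for square integrable functions.
\<close>

lemma integral_sum_sq_orthogonal:
  fixes Z :: "nat \<Rightarrow> 'a \<Rightarrow> real"
  assumes I: "finite I" and meas: "\<And>t. t \<in> I \<Longrightarrow> Z t \<in> borel_measurable P"
    and sq: "\<And>t. t \<in> I \<Longrightarrow> integrable P (\<lambda>x. (Z t x)\<^sup>2)"
    and orth: "\<And>s t. s \<in> I \<Longrightarrow> t \<in> I \<Longrightarrow> s \<noteq> t \<Longrightarrow> (\<integral>x. Z s x * Z t x \<partial>P) = 0"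
  shows "integrable P (\<lambda>x. (\<Sum>t\<in>I. Z t x)\<^sup>2)"
    and "(\<integral>x. (\<Sum>t\<in>I. Z t x)\<^sup>2 \<partial>P) = (\<Sum>t\<in>I. \<integral>x. (Z t x)\<^sup>2 \<partial>P)"
proof -
  have eq: "(\<Sum>t\<in>I. Z t x)\<^sup>2 = (\<Sum>s\<in>I. \<Sum>t\<in>I. Z s x * Z t x)" for x
    by (simp add: power2_eq_square sum_product)
  have int: "integrable P (\<lambda>x. Z s x * Z t x)" if "s \<in> I" "t \<in> I" for s t
    using that by (intro integrable_mult_of_squares meas sq)
  show "integrable P (\<lambda>x. (\<Sum>t\<in>I. Z t x)\<^sup>2)" unfolding eq using int by simp
  have "(\<integral>x. (\<Sum>t\<in>I. Z t x)\<^sup>2 \<partial>P) = (\<Sum>s\<in>I. \<Sum>t\<in>I. \<integral>x. Z s x * Z t x \<partial>P)"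
    unfolding eq using int by (simp add: Bochner_Integration.integral_sum)
  also have "\<dots> = (\<Sum>s\<in>I. \<Sum>t\<in>I. if s = t then \<integral>x. (Z s x)\<^sup>2 \<partial>P else 0)"
    using orth by (intro sum.cong refl) (auto simp: power2_eq_square)
  also have "\<dots> = (\<Sum>t\<in>I. \<integral>x. (Z t x)\<^sup>2 \<partial>P)" using I by simp
  finally show "(\<integral>x. (\<Sum>t\<in>I. Z t x)\<^sup>2 \<partial>P) = (\<Sum>t\<in>I. \<integral>x. (Z t x)\<^sup>2 \<partial>P)" .
qed

text \<open>
  The summands \<open>Z k t\<close> of the components of the objective have mean zero: for \<open>k = 0\<close> by the
  last assumption, which is the constraint summed over all cells, and for \<open>k > 0\<close> because the
  components of a regressor are independent with mean zero. As they are uncorrelated in time, they are orthogonal, and only the \<open>N\<close> diagonal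
  terms survive.
\<close>

lemma V_rot_UE_eq:
  assumes fir: "fir_model n N \<kappa> \<theta>1 P u T \<theta>" and unc: "uncorrelated_in_time n N \<kappa> P u T"
    and \<kappa>: "0 < \<kappa>"
    and meas [measurable]: "err_fun \<theta>1 q \<in> borel_measurable borel"
    and bdd: "\<And>x. x \<in> {-\<kappa>..\<kappa>} \<Longrightarrow> \<bar>err_fun \<theta>1 q x\<bar> \<le> B"
    and mean: "(\<integral>x. unif_pdf \<kappa> x * (x * err_fun \<theta>1 q x) \<partial>lborel) = 0"
  shows "V_rot_UE n N P u T \<theta> q =
      (\<Sum>k<n. \<integral>\<omega>. (\<Sum>t=1..N. rot_regressor n u T \<omega> t k *
         err_fun \<theta>1 q (rot_regressor n u T \<omega> t 0))\<^sup>2 \<partial>P)" (is ?A)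
    and "V_rot_UE n N P u T \<theta> q =
      real N * (\<integral>x. unif_pdf \<kappa> x * ((x\<^sup>2 + (real n - 1) * \<kappa>\<^sup>2 / 3) * (err_fun \<theta>1 q x)\<^sup>2) \<partial>lborel)" (is ?B)
proof -
  note m = fir_modelD[OF fir]
  define e where "e = err_fun \<theta>1 q"
  have [measurable]: "e \<in> borel_measurable borel" by (simp add: e_def)
  have [measurable]: "(\<lambda>\<omega>. rot_regressor n u T \<omega> t k) \<in> borel_measurable P" for t k
    by (rule rot_regressor_measurable[OF fir])
  define Z where "Z k t \<omega> = rot_regressor n u T \<omega> t k * e (rot_regressor n u T \<omega> t 0)" for k t \<omega>
  have e2: "(e x)\<^sup>2 \<le> B\<^sup>2" if "x \<in> {-\<kappa>..\<kappa>}" for x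
    using bdd[OF that] by (simp add: e_def flip: abs_le_square_iff)
  have x2: "x\<^sup>2 \<le> \<kappa>\<^sup>2" if "x \<in> {-\<kappa>..\<kappa>}" for x
    using that by (auto simp flip: abs_le_square_iff)
  have int_x: "integrable lborel (\<lambda>x. unif_pdf \<kappa> x * x)"
    by (rule integrable_unif_pdf[where B = \<kappa>]) auto
  have int_x2: "integrable lborel (\<lambda>x. unif_pdf \<kappa> x * x\<^sup>2)"
    by (rule integrable_unif_pdf[where B = "\<kappa>\<^sup>2"]) (use x2 in auto)
  have int_e: "integrable lborel (\<lambda>x. unif_pdf \<kappa> x * e x)"
    by (rule integrable_unif_pdf[where B = B]) (use bdd in \<open>auto simp: e_def\<close>)
  have int_e2: "integrable lborel (\<lambda>x. unif_pdf \<kappa> x * (e x)\<^sup>2)"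
    by (rule integrable_unif_pdf[where B = "B\<^sup>2"]) (use e2 in auto)
  have int_xe: "integrable lborel (\<lambda>x. unif_pdf \<kappa> x * (x * e x))"
    by (rule integrable_unif_pdf[where B = "\<kappa> * B"])
      (use bdd \<kappa> in \<open>auto simp: e_def abs_mult intro!: mult_mono\<close>)
  have int_xe2: "integrable lborel (\<lambda>x. unif_pdf \<kappa> x * (x * e x)\<^sup>2)"
    by (rule integrable_unif_pdf[where B = "\<kappa>\<^sup>2 * B\<^sup>2"])
      (use e2 x2 in \<open>auto simp: power_mult_distrib intro!: mult_mono\<close>)
  have Z_mean: "(\<integral>\<omega>. Z k t \<omega> \<partial>P) = 0" if "t \<in> {1..N}" "k < n" for t k
  proof (cases "k = 0")
    case True
    then show ?thesis
      using expectation_leading(2)[OF fir \<kappa> that(1) _ int_xe] mean by (simp add: Z_def e_def)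
  next
    case False
    then show ?thesis
      using expectation_pair(2)[OF fir \<kappa> that(1) _ that(2) _ int_x _ int_e] unif_pdf_moments(3)[OF \<kappa>]
      by (simp add: Z_def)
  qed
  have Z_sq: "integrable P (\<lambda>\<omega>. (Z k t \<omega>)\<^sup>2) \<and> (\<integral>\<omega>. (Z k t \<omega>)\<^sup>2 \<partial>P) =
      (if k = 0 then \<integral>x. unif_pdf \<kappa> x * (x * e x)\<^sup>2 \<partial>lborel
       else \<kappa>\<^sup>2 / 3 * (\<integral>x. unif_pdf \<kappa> x * (e x)\<^sup>2 \<partial>lborel))" if "t \<in> {1..N}" "k < n" for t k
  proof (cases "k = 0")
    case True
    then show ?thesis
      using expectation_leading[OF fir \<kappa> that(1) _ int_xe2] by (simp add: Z_def)
  next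
    case False
    then show ?thesis
      using expectation_pair[OF fir \<kappa> that(1) _ that(2) _ int_x2 _ int_e2] unif_pdf_moments(4)[OF \<kappa>]
      by (simp add: Z_def power_mult_distrib)
  qed
  have bdd': "bounded (e ` {-\<kappa>..\<kappa>})"
    using bdd by (auto simp: bounded_iff e_def intro!: exI[of _ B])
  have orth: "(\<integral>\<omega>. Z k s \<omega> * Z k t \<omega> \<partial>P) = 0"
    if "s \<in> {1..N}" "t \<in> {1..N}" "s \<noteq> t" "k < n" for s t k
  proof -
    have "(\<integral>\<omega>. Z k s \<omega> * Z k t \<omega> \<partial>P) = (\<integral>\<omega>. Z k s \<omega> \<partial>P) * (\<integral>\<omega>. Z k t \<omega> \<partial>P)"
      using unc that bdd' unfolding uncorrelated_in_time_def Let_def Z_def by auto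
    then show ?thesis using Z_mean that by simp
  qed
  have Zm: "Z k t \<in> borel_measurable P" for k t unfolding Z_def[abs_def] by measurable
  have sum_sq: "integrable P (\<lambda>\<omega>. (\<Sum>t=1..N. Z k t \<omega>)\<^sup>2)"
    "(\<integral>\<omega>. (\<Sum>t=1..N. Z k t \<omega>)\<^sup>2 \<partial>P) = (\<Sum>t=1..N. \<integral>\<omega>. (Z k t \<omega>)\<^sup>2 \<partial>P)" if "k < n" for k
    using integral_sum_sq_orthogonal[of "{1..N}" "Z k" P] Zm Z_sq orth that by auto
  have "V_rot_UE n N P u T \<theta> q = (\<integral>\<omega>. (\<Sum>k<n. (\<Sum>t=1..N. Z k t \<omega>)\<^sup>2) \<partial>P)"
    by (simp add: V_rot_UE_def mean_sq_norm_def transpose_mult_def quant_error_eq[OF fir] Z_def e_def)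
  also have "\<dots> = (\<Sum>k<n. \<integral>\<omega>. (\<Sum>t=1..N. Z k t \<omega>)\<^sup>2 \<partial>P)"
    using sum_sq by (intro Bochner_Integration.integral_sum) auto
  finally have V: "V_rot_UE n N P u T \<theta> q = (\<Sum>k<n. \<integral>\<omega>. (\<Sum>t=1..N. Z k t \<omega>)\<^sup>2 \<partial>P)" .
  then show ?A by (simp add: Z_def e_def)
  have split: "{..<n} = insert 0 {1..<n}" using m(1) by auto
  have "V_rot_UE n N P u T \<theta> q = (\<Sum>k<n. real N * (if k = 0 then \<integral>x. unif_pdf \<kappa> x * (x * e x)\<^sup>2 \<partial>lborel
       else \<kappa>\<^sup>2 / 3 * (\<integral>x. unif_pdf \<kappa> x * (e x)\<^sup>2 \<partial>lborel)))"
    unfolding V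
  proof (intro sum.cong refl)
    fix k assume k: "k \<in> {..<n}"
    then have "(\<integral>\<omega>. (\<Sum>t=1..N. Z k t \<omega>)\<^sup>2 \<partial>P) = (\<Sum>t=1..N. \<integral>\<omega>. (Z k t \<omega>)\<^sup>2 \<partial>P)"
      by (intro sum_sq) simp
    also have "\<dots> = (\<Sum>t=1..N. if k = 0 then \<integral>x. unif_pdf \<kappa> x * (x * e x)\<^sup>2 \<partial>lborel
       else \<kappa>\<^sup>2 / 3 * (\<integral>x. unif_pdf \<kappa> x * (e x)\<^sup>2 \<partial>lborel))"
      using k Z_sq by (intro sum.cong refl) auto
    finally show "(\<integral>\<omega>. (\<Sum>t=1..N. Z k t \<omega>)\<^sup>2 \<partial>P) = real N * (if k = 0
       then \<integral>x. unif_pdf \<kappa> x * (x * e x)\<^sup>2 \<partial>lborel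
       else \<kappa>\<^sup>2 / 3 * (\<integral>x. unif_pdf \<kappa> x * (e x)\<^sup>2 \<partial>lborel))" by simp
  qed
  also have "\<dots> = real N * ((\<integral>x. unif_pdf \<kappa> x * (x * e x)\<^sup>2 \<partial>lborel)
      + (real n - 1) * (\<kappa>\<^sup>2 / 3 * (\<integral>x. unif_pdf \<kappa> x * (e x)\<^sup>2 \<partial>lborel)))"
    unfolding split using m(1) by (simp add: of_nat_diff algebra_simps)
  also have "(\<integral>x. unif_pdf \<kappa> x * (x * e x)\<^sup>2 \<partial>lborel)
      + (real n - 1) * (\<kappa>\<^sup>2 / 3 * (\<integral>x. unif_pdf \<kappa> x * (e x)\<^sup>2 \<partial>lborel))
    = (\<integral>x. unif_pdf \<kappa> x * (x * e x)\<^sup>2 + (real n - 1) * (\<kappa>\<^sup>2 / 3) * (unif_pdf \<kappa> x * (e x)\<^sup>2) \<partial>lborel)"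
    using int_xe2 int_e2 by simp
  also have "\<dots> = (\<integral>x. unif_pdf \<kappa> x * ((x\<^sup>2 + (real n - 1) * \<kappa>\<^sup>2 / 3) * (e x)\<^sup>2) \<partial>lborel)"
    by (intro Bochner_Integration.integral_cong refl) (simp add: algebra_simps power_mult_distrib)
  finally show ?B by (simp add: e_def)
qed

section \<open>Feasible quantizers\<close>

text \<open>
  The constraint leaves no freedom in the quantized values: on each cell the error is proportional to the
  deviation from the centroid of the cell.
\<close>

lemma feasible_cells:
  assumes n: "1 \<le> n" and \<kappa>: "0 < \<kappa>" and \<theta>1: "0 < \<theta>1" and feas: "feasible n \<kappa> \<theta>1 M d q"
  defines "X \<equiv> \<lambda>j. d (int j) / \<theta>1"
  shows "X 0 = 0" and "X (M div 2) = \<kappa>" and "\<And>j. j < M div 2 \<Longrightarrow> X j < X (Suc j)"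
    and "\<exists>v. q = odd_step (M div 2) (\<lambda>j. d (int j)) v"
    and "\<And>j x. j < M div 2 \<Longrightarrow> x \<in> {X j<..X (Suc j)} \<Longrightarrow>
      err_fun \<theta>1 q x = \<theta>1 * centroid (X j) (X (Suc j)) - \<theta>1 * x"
proof -
  let ?m = "M div 2"
  have quant: "is_quantizer ?m (\<kappa> * \<theta>1) d q" using feas by (simp add: feasible_def)
  note Q = is_quantizerD[OF quant]
  show X0: "X 0 = 0" using Q(1) by (simp add: X_def)
  show Xm: "X ?m = \<kappa>" using Q(2) \<theta>1 by (simp add: X_def)
  show inc: "X j < X (Suc j)" if "j < ?m" for j
    using Q(3)[OF that] \<theta>1 unfolding X_def by (intro divide_strict_right_mono)
  show "\<exists>v. q = odd_step ?m (\<lambda>j. d (int j)) v" by (rule Q(4))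
  then obtain v where q: "q = odd_step ?m (\<lambda>j. d (int j)) v" by blast
  fix j x assume j: "j < ?m" and x: "x \<in> {X j<..X (Suc j)}"
  have nonneg: "0 \<le> X j"
    using partition_le[of ?m X 0 j] inc X0 j by simp
  have le: "X (Suc j) \<le> \<kappa>"
    using partition_le[of ?m X "Suc j" ?m] inc Xm j by simp
  have err: "err_fun \<theta>1 q y = v j - \<theta>1 * y" if y: "y \<in> {X j<..X (Suc j)}" for y
  proof -
    have "\<theta>1 * y \<in> {d (int j)<..d (int (Suc j))}"
      using y \<theta>1 by (auto simp: X_def field_simps)
    then have "q (\<theta>1 * y) = v j"
      unfolding q using Q(1) Q(3) j by (intro odd_step_cell) auto
    then show ?thesis by (simp add: err_fun_def)
  qed
  have cell: "{x. \<theta>1 * x \<in> cell d (int (Suc j))} = {X j<..X (Suc j)}"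
    using \<theta>1 by (auto simp: cell_def X_def field_simps)
  have "int (Suc j) \<in> {- int ?m..int ?m}" using j by auto
  with feas have "(LINT x:{x. \<theta>1 * x \<in> cell d (int (Suc j))}|lborel.
      x * err_fun \<theta>1 q x * marg_density n \<kappa> x) = 0"
    unfolding feasible_def by blast
  also have "(LINT x:{x. \<theta>1 * x \<in> cell d (int (Suc j))}|lborel.
      x * err_fun \<theta>1 q x * marg_density n \<kappa> x) =
      (LINT x:{X j<..X (Suc j)}|lborel. x * (v j - \<theta>1 * x) * (1 / (2 * \<kappa>)))"
    unfolding cell marg_density_eq[OF n \<kappa>]
    by (intro set_lebesgue_integral_cong) (use nonneg le \<kappa> in \<open>auto simp: err unif_pdf_def\<close>)
  also have "\<dots> = (LINT x:{X j<..X (Suc j)}|lborel. x * (v j - \<theta>1 * x)) * (1 / (2 * \<kappa>))"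
    by (rule set_integral_mult_left)
  finally have "(LINT x:{X j<..X (Suc j)}|lborel. x * (v j - \<theta>1 * x)) = 0" using \<kappa> by simp
  then have "v j = \<theta>1 * centroid (X j) (X (Suc j))"
    using cell_moment_zero_iff[OF nonneg inc[OF j]] by simp
  then show "err_fun \<theta>1 q x = \<theta>1 * centroid (X j) (X (Suc j)) - \<theta>1 * x"
    using err[OF x] by simp
qed

lemma err_fun_odd_step:
  assumes "0 < \<kappa>" and "0 < \<theta>1" and q: "q = odd_step m X v"
  shows "err_fun \<theta>1 q \<in> borel_measurable borel"
    and "err_fun \<theta>1 q (- x) = - err_fun \<theta>1 q x"
    and "x \<in> {-\<kappa>..\<kappa>} \<Longrightarrow> \<bar>err_fun \<theta>1 q x\<bar> \<le> (\<Sum>j<m. \<bar>v j\<bar>) + \<theta>1 * \<kappa>"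
proof -
  have [measurable]: "q \<in> borel_measurable borel" unfolding q by (rule odd_step_measurable)
  show "err_fun \<theta>1 q \<in> borel_measurable borel" unfolding err_fun_def[abs_def] by measurable
  show "err_fun \<theta>1 q (- x) = - err_fun \<theta>1 q x"
    using odd_step_minus[of m X v "\<theta>1 * x"] by (simp add: err_fun_def q)
  show "\<bar>err_fun \<theta>1 q x\<bar> \<le> (\<Sum>j<m. \<bar>v j\<bar>) + \<theta>1 * \<kappa>" if "x \<in> {-\<kappa>..\<kappa>}"
  proof -
    have "\<bar>\<theta>1 * x\<bar> \<le> \<theta>1 * \<kappa>" using that assms by (auto simp: abs_mult intro!: mult_left_mono)
    then show ?thesis
      using odd_step_bounded[of m X v "\<theta>1 * x"] by (simp add: err_fun_def q)
  qed
qed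

text \<open>
  The objective divided by \<open>N * \<theta>1\<^sup>2 * \<kappa> ^ 4\<close> as a function of the ratios: the leading component
  contributes the first term, the remaining \<open>n - 1\<close> components the second.
\<close>

definition normalized_cost :: "nat \<Rightarrow> nat \<Rightarrow> (nat \<Rightarrow> real) \<Rightarrow> real" where
  "normalized_cost n k r = nested_cost 5 (\<lambda>r. psi r 0) k r / 2160
     + (real n - 1) * nested_cost 3 (\<lambda>r. xi r 0) k r / 108"

lemma feasible_error_integrals:
  assumes n: "1 \<le> n" and \<kappa>: "0 < \<kappa>" and \<theta>1: "0 < \<theta>1" and M: "2 \<le> M"
    and feas: "feasible n \<kappa> \<theta>1 M d q"
  shows "(\<integral>x. unif_pdf \<kappa> x * (x * err_fun \<theta>1 q x) \<partial>lborel) = 0" (is ?mean)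
    and "(\<integral>x. unif_pdf \<kappa> x * ((x\<^sup>2 + (real n - 1) * \<kappa>\<^sup>2 / 3) * (err_fun \<theta>1 q x)\<^sup>2) \<partial>lborel) =
      \<theta>1\<^sup>2 * \<kappa> ^ 4 * normalized_cost n (M div 2 - 1) (\<lambda>j. d (int j) / d (int (Suc j)))" (is ?sq)
proof -
  let ?m = "M div 2"
  define X where "X j = d (int j) / \<theta>1" for j
  note F = feasible_cells[OF n \<kappa> \<theta>1 feas, folded X_def]
  obtain v where q: "q = odd_step ?m (\<lambda>j. d (int j)) v" using F(4) by blast
  define e where "e = err_fun \<theta>1 q"
  have [measurable]: "e \<in> borel_measurable borel" and odd: "e (- x) = - e x" for x
    using err_fun_odd_step[OF \<kappa> \<theta>1 q] by (auto simp: e_def)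
  have nonneg: "0 \<le> X j" if "j \<le> ?m" for j
    using partition_le[of ?m X 0 j] F(1,3) that by simp
  have e: "e x = \<theta>1 * centroid (X j) (X (Suc j)) - \<theta>1 * x" if "j < ?m" "x \<in> {X j<..X (Suc j)}" for j x
    using F(5)[OF that] by (simp add: e_def)
  \<comment> \<open>both integrands are even, so it is enough to sum over the positive cells\<close>
  have by_cells: "(\<integral>x. unif_pdf \<kappa> x * f x \<partial>lborel) = (\<Sum>j<?m. I j) / \<kappa>"
    if [measurable]: "f \<in> borel_measurable borel" and even: "\<And>x. f (- x) = f x"
      and int: "\<And>j. j < ?m \<Longrightarrow> set_integrable lborel {X j<..X (Suc j)} f"
      and I: "\<And>j. j < ?m \<Longrightarrow> (LINT x:{X j<..X (Suc j)}|lborel. f x) = I j"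
    for f :: "real \<Rightarrow> real" and I :: "nat \<Rightarrow> real"
  proof -
    have sum: "set_integrable lborel {0<..\<kappa>} f" "(LINT x:{0<..\<kappa>}|lborel. f x) = (\<Sum>j<?m. I j)"
      using Ioc_integral_sum[of ?m X f, OF less_imp_le[OF F(3)] int] I F(1,2) by auto
    have "(\<integral>x. unif_pdf \<kappa> x * f x \<partial>lborel) = (\<integral>x. indicator {-\<kappa>..\<kappa>} x * f x \<partial>lborel) / (2 * \<kappa>)"
      unfolding unif_pdf_def by (simp flip: integral_divide_zero)
    also have "(\<integral>x. indicator {-\<kappa>..\<kappa>} x * f x \<partial>lborel) = 2 * (\<Sum>j<?m. I j)"
      using integral_even[OF even sum(1)] \<kappa> sum(2) by simp
    finally show ?thesis by simp
  qed
  have "(\<integral>x. unif_pdf \<kappa> x * (x * e x) \<partial>lborel) = (\<Sum>j<?m. 0) / \<kappa>"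
  proof (rule by_cells)
    fix j assume j: "j < ?m"
    let ?v = "\<theta>1 * centroid (X j) (X (Suc j))"
    have "set_integrable lborel {X j..X (Suc j)} (\<lambda>x. x * (?v - \<theta>1 * x))"
      by (intro borel_integrable_atLeastAtMost' continuous_intros)
    then have "set_integrable lborel {X j<..X (Suc j)} (\<lambda>x. x * (?v - \<theta>1 * x))"
      by (rule set_integrable_subset) auto
    then show "set_integrable lborel {X j<..X (Suc j)} (\<lambda>x. x * e x)"
      using e[OF j] by (subst set_integrable_cong[OF refl refl]) auto
    have "(LINT x:{X j<..X (Suc j)}|lborel. x * e x) = (LINT x:{X j<..X (Suc j)}|lborel. x * (?v - \<theta>1 * x))"
      using e[OF j] by (intro set_lebesgue_integral_cong) auto
    also have "\<dots> = 0"
      using cell_moment_zero_iff[of "X j" "X (Suc j)" ?v \<theta>1] nonneg F(3)[OF j] j by simp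
    finally show "(LINT x:{X j<..X (Suc j)}|lborel. x * e x) = 0" .
  qed (auto simp: odd)
  then show ?mean by (simp add: e_def)
  define \<beta> where "\<beta> = (real n - 1) * \<kappa>\<^sup>2 / 3"
  define S where "S p c = (\<Sum>j<?m. X (Suc j) ^ p * c (X j / X (Suc j)))" for p and c :: "real \<Rightarrow> real"
  have "(\<integral>x. unif_pdf \<kappa> x * ((x\<^sup>2 + \<beta>) * (e x)\<^sup>2) \<partial>lborel) =
    (\<Sum>j<?m. \<theta>1\<^sup>2 * (X (Suc j) ^ 5 * psi (X j / X (Suc j)) 0 / 2160
      + \<beta> * (X (Suc j) ^ 3 * xi (X j / X (Suc j)) 0) / 36)) / \<kappa>"
  proof (rule by_cells)
    fix j assume j: "j < ?m"
    let ?v = "\<theta>1 * centroid (X j) (X (Suc j))"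
    have "0 \<le> X j" using nonneg j by simp
    note C = cell_error_integral[OF this F(3)[OF j] refl, where \<theta> = \<theta>1 and \<beta> = \<beta>]
    show "set_integrable lborel {X j<..X (Suc j)} (\<lambda>x. (x\<^sup>2 + \<beta>) * (e x)\<^sup>2)"
      using C(1) e[OF j] by (subst set_integrable_cong[OF refl refl]) auto
    have "(LINT x:{X j<..X (Suc j)}|lborel. (x\<^sup>2 + \<beta>) * (e x)\<^sup>2) =
        (LINT x:{X j<..X (Suc j)}|lborel. (x\<^sup>2 + \<beta>) * (?v - \<theta>1 * x)\<^sup>2)"
      using e[OF j] by (intro set_lebesgue_integral_cong) auto
    also note C(2)
    finally show "(LINT x:{X j<..X (Suc j)}|lborel. (x\<^sup>2 + \<beta>) * (e x)\<^sup>2) =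
        \<theta>1\<^sup>2 * (X (Suc j) ^ 5 * psi (X j / X (Suc j)) 0 / 2160
      + \<beta> * (X (Suc j) ^ 3 * xi (X j / X (Suc j)) 0) / 36)" .
  qed (auto simp: odd)
  also have "(\<Sum>j<?m. \<theta>1\<^sup>2 * (X (Suc j) ^ 5 * psi (X j / X (Suc j)) 0 / 2160
      + \<beta> * (X (Suc j) ^ 3 * xi (X j / X (Suc j)) 0) / 36))
    = \<theta>1\<^sup>2 * (S 5 (\<lambda>r. psi r 0) / 2160 + \<beta> * S 3 (\<lambda>r. xi r 0) / 36)"
    by (simp only: S_def sum_distrib_left sum_divide_distrib sum.distrib[symmetric])
  finally have sq: "(\<integral>x. unif_pdf \<kappa> x * ((x\<^sup>2 + \<beta>) * (e x)\<^sup>2) \<partial>lborel) =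
    \<theta>1\<^sup>2 * (S 5 (\<lambda>r. psi r 0) / 2160 + \<beta> * S 3 (\<lambda>r. xi r 0) / 36) / \<kappa>" .
  have m: "Suc (?m - 1) = ?m" using M by linarith
  have pos: "0 < X (Suc j)" if "j \<le> ?m - 1" for j
    using partition_less[of ?m X 0 "Suc j"] F(1,3) that m by simp
  have ratio: "X j / X (Suc j) = d (int j) / d (int (Suc j))" for j
    using \<theta>1 by (simp add: X_def)
  have S: "S p c = \<kappa> ^ p * nested_cost p c (?m - 1) (\<lambda>j. d (int j) / d (int (Suc j)))" for p c
    using sum_cells_eq_nested_cost[where X = X and k = "?m - 1" and p = p and c = c, OF F(1) pos]
    unfolding m ratio S_def F(2) by simp
  have "\<theta>1\<^sup>2 * (\<kappa> ^ 5 * a / 2160 + \<beta> * (\<kappa> ^ 3 * b) / 36) / \<kappa> =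
      \<theta>1\<^sup>2 * \<kappa> ^ 4 * (a / 2160 + (real n - 1) * b / 108)" for a b
    using \<kappa> unfolding \<beta>_def by (simp add: field_simps eval_nat_numeral)
  then have "(\<integral>x. unif_pdf \<kappa> x * ((x\<^sup>2 + \<beta>) * (e x)\<^sup>2) \<partial>lborel) =
      \<theta>1\<^sup>2 * \<kappa> ^ 4 * normalized_cost n (?m - 1) (\<lambda>j. d (int j) / d (int (Suc j)))"
    unfolding sq S normalized_cost_def by blast
  then show ?sq unfolding e_def \<beta>_def .
qed

lemma V_UE_feasible:
  assumes fir: "fir_model n N \<kappa> \<theta>1 P u T \<theta>" and unc: "uncorrelated_in_time n N \<kappa> P u T"
    and \<kappa>: "0 < \<kappa>" and \<theta>1: "0 < \<theta>1" and M: "2 \<le> M" and feas: "feasible n \<kappa> \<theta>1 M d q"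
  shows "V_rot_UE n N P u T \<theta> q =
            (\<Sum>k<n. \<integral>\<omega>. (\<Sum>t=1..N. rot_regressor n u T \<omega> t k *
               err_fun \<theta>1 q (rot_regressor n u T \<omega> t 0))\<^sup>2 \<partial>P)" (is ?A)
    and "V_rot_UE n N P u T \<theta> q =
            real N * (\<integral>x. sigma_sq n \<kappa> x * (err_fun \<theta>1 q x)\<^sup>2 * marg_density n \<kappa> x \<partial>lborel)" (is ?B)
    and "V_UE n N P u \<theta> q = real N * \<theta>1\<^sup>2 * \<kappa> ^ 4 *
            normalized_cost n (M div 2 - 1) (\<lambda>j. d (int j) / d (int (Suc j)))" (is ?C)
proof -
  have n: "1 \<le> n" using fir_modelD(1)[OF fir] .
  obtain v where q: "q = odd_step (M div 2) (\<lambda>j. d (int j)) v"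
    using feasible_cells(4)[OF n \<kappa> \<theta>1 feas] by blast
  note V = V_rot_UE_eq[OF fir unc \<kappa> err_fun_odd_step(1,3)[OF \<kappa> \<theta>1 q]
      feasible_error_integrals(1)[OF n \<kappa> \<theta>1 M feas]]
  show ?A by (rule V(1))
  have integrand: "sigma_sq n \<kappa> x * (err_fun \<theta>1 q x)\<^sup>2 * marg_density n \<kappa> x =
      unif_pdf \<kappa> x * ((x\<^sup>2 + (real n - 1) * \<kappa>\<^sup>2 / 3) * (err_fun \<theta>1 q x)\<^sup>2)" for x
    using sigma_sq_marg_density[OF n \<kappa>, of x] by (metis mult.assoc mult.commute)
  show ?B unfolding integrand by (rule V(2))
  show ?C
    using V_UE_eq_V_rot_UE[OF fir] V(2) feasible_error_integrals(2)[OF n \<kappa> \<theta>1 M feas]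
    by (simp add: mult.assoc)
qed

lemma centroid_scale: "0 < \<theta> \<Longrightarrow> centroid a b = \<theta> * centroid (a / \<theta>) (b / \<theta>)"
proof -
  assume \<theta>: "0 < \<theta>"
  define A B where "A = a / \<theta>" and "B = b / \<theta>"
  have ab: "a = \<theta> * A" "b = \<theta> * B" using \<theta> by (simp_all add: A_def B_def)
  have "centroid a b = (\<theta> * (\<theta> * (2 * (A\<^sup>2 + A * B + B\<^sup>2)))) / (\<theta> * (3 * (A + B)))"
    unfolding ab centroid_def by (simp add: power2_eq_square algebra_simps)
  also have "\<dots> = \<theta> * centroid A B" using \<theta> by (simp add: centroid_def)
  finally show ?thesis by (simp add: A_def B_def)
qed

text \<open>
  Every vector of ratios in the open unit interval is realized: the boundaries are the partial products of
  the ratios, counted from the outermost boundary \<open>\<kappa> * \<theta>1\<close>, and the values are the centroids.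
  The cells on the negative side satisfy the constraint by reflection.
\<close>

lemma feasible_exists:
  assumes n: "1 \<le> n" and \<kappa>: "0 < \<kappa>" and \<theta>1: "0 < \<theta>1" and M: "2 \<le> M"
    and r: "\<And>j. j \<in> {1..<M div 2} \<Longrightarrow> 0 < r j \<and> r j < 1"
  shows "\<exists>d q. feasible n \<kappa> \<theta>1 M d q \<and> (\<forall>j\<in>{1..<M div 2}. d (int j) = r j * d (int (Suc j)))"
proof -
  define m where "m = M div 2"
  have m: "1 \<le> m" using M by (simp add: m_def)
  define D where "D j = (if j = 0 then 0 else \<kappa> * \<theta>1 * (\<Prod>i\<in>{j..<m}. r i))" for j
  define d where "d k = (if k < 0 then - D (nat (- k)) else D (nat k))" for k :: int
  define v where "v j = centroid (D j) (D (Suc j))" for j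
  define q where "q = odd_step m D v"
  have d_int: "d (int j) = D j" "d (- int j) = - D j" for j
    by (auto simp: d_def D_def)
  have D0: "D 0 = 0" and Dm: "D m = \<kappa> * \<theta>1" using m by (auto simp: D_def)
  have D_pos: "0 < D j" if "1 \<le> j" for j
    using that \<kappa> \<theta>1 r by (auto simp: D_def m_def intro!: mult_pos_pos prod_pos)
  have D_rec: "D j = r j * D (Suc j)" if "j \<in> {1..<m}" for j
    using that by (simp add: D_def prod.atLeast_Suc_lessThan)
  have inc: "D j < D (Suc j)" if "j < m" for j
  proof (cases "j = 0")
    case True
    then show ?thesis using D_pos[of "Suc j"] D0 by simp
  next
    case False
    then have "r j * D (Suc j) < 1 * D (Suc j)"
      using that r[of j] D_pos[of "Suc j"] by (intro mult_strict_right_mono) (auto simp: m_def)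
    then show ?thesis using D_rec[of j] that False by simp
  qed
  have q_cell: "q y = v j" if "j < m" "y \<in> {D j<..D (Suc j)}" for j y
    unfolding q_def by (rule odd_step_cell[OF D0 inc that])
  have q_odd: "q (- y) = - q y" for y unfolding q_def by (rule odd_step_minus)
  have cell_pos: "cell d (int (Suc j)) = {D j<..D (Suc j)}" for j
    using d_int(1)[of j] d_int(1)[of "Suc j"] by (simp add: cell_def)
  have cell_neg: "y \<in> cell d (- int (Suc j)) \<longleftrightarrow> - y \<in> {D j<..D (Suc j)}" for j y
  proof -
    have "- int (Suc j) + 1 = - int j" by simp
    then have "cell d (- int (Suc j)) = {- D (Suc j)..<- D j}"
      using d_int(2)[of j] d_int(2)[of "Suc j"] by (simp add: cell_def)
    then show ?thesis by auto
  qed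
  have cases_int: "P k" if "k \<in> {- int m..int m}" "P 0" "\<And>j. j < m \<Longrightarrow> P (int (Suc j))"
    "\<And>j. j < m \<Longrightarrow> P (- int (Suc j))" for P and k :: int
  proof -
    consider "k = 0" | "0 < k" | "k < 0" by linarith
    then show ?thesis
    proof cases
      case 2
      then have "k = int (Suc (nat (k - 1)))" "nat (k - 1) < m" using that(1) by auto
      then show ?thesis using that(3) by metis
    next
      case 3
      then have "k = - int (Suc (nat (- k - 1)))" "nat (- k - 1) < m" using that(1) by auto
      then show ?thesis using that(4) by metis
    qed (use that(2) in simp)
  qed
  have "\<exists>w. \<forall>k\<in>{- int m..int m}. \<forall>y\<in>cell d k. q y = w k"
  proof (intro exI ballI)
    fix k y assume k: "k \<in> {- int m..int m}" and y: "y \<in> cell d k"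
    define w where "w k = (if k = 0 then 0 else if 0 < k then v (nat (k - 1)) else - v (nat (- k - 1)))"
      for k :: int
    have "\<forall>y\<in>cell d k. q y = w k"
    proof (rule cases_int[OF k, of "\<lambda>k. \<forall>y\<in>cell d k. q y = w k"])
      show "\<forall>y\<in>cell d 0. q y = w 0"
        using q_odd[of 0] by (simp add: cell_def w_def)
      show "\<forall>y\<in>cell d (int (Suc j)). q y = w (int (Suc j))" if "j < m" for j
        unfolding cell_pos using q_cell[OF that] by (simp add: w_def)
      show "\<forall>y\<in>cell d (- int (Suc j)). q y = w (- int (Suc j))" if "j < m" for j
      proof
        fix y assume "y \<in> cell d (- int (Suc j))"
        then have "q (- y) = v j" unfolding cell_neg by (rule q_cell[OF that])
        then show "q y = w (- int (Suc j))" using q_odd[of y] by (simp add: w_def)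
      qed
    qed
    then show "q y = (if k = 0 then 0 else if 0 < k then v (nat (k - 1)) else - v (nat (- k - 1)))"
      using y by (simp add: w_def)
  qed
  moreover have "\<forall>j\<in>{0..<int m}. d j < d (j + 1)"
  proof
    fix j assume "j \<in> {0..<int m}"
    then show "d j < d (j + 1)"
      using inc[of "nat j"] by (auto simp: d_def nat_add_distrib)
  qed
  moreover have "\<forall>j\<in>{0..int m}. d (- j) = - d j" by (auto simp: d_def D0)
  moreover have "\<forall>y. \<bar>y\<bar> > \<kappa> * \<theta>1 \<longrightarrow> q y = 0"
    unfolding q_def using odd_step_outside[of D m _ v, OF D0 inc] Dm by auto
  ultimately have quant: "is_quantizer m (\<kappa> * \<theta>1) d q"
    unfolding is_quantizer_def using q_odd d_int(1)[of 0] D0 d_int(1)[of m] Dm by auto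
  define f where "f x = x * err_fun \<theta>1 q x * marg_density n \<kappa> x" for x
  have f_even: "f (- x) = f x" for x
    using err_fun_odd_step(2)[OF \<kappa> \<theta>1 q_def]
    by (auto simp: f_def marg_density_eq[OF n \<kappa>] unif_pdf_def indicator_def)
  have pos: "(LINT x:{x. \<theta>1 * x \<in> cell d (int (Suc j))}|lborel. f x) = 0" if j: "j < m" for j
  proof -
    define a b where "a = D j / \<theta>1" and "b = D (Suc j) / \<theta>1"
    have ab: "0 \<le> a" "a < b"
      using D_pos[of j] D0 inc[OF j] \<theta>1 by (cases "j = 0"; auto simp: a_def b_def divide_strict_right_mono)+
    have "D (Suc j) \<le> \<kappa> * \<theta>1"
      using partition_le[of m D "Suc j" m] inc j Dm by simp
    then have b: "b \<le> \<kappa>" using \<theta>1 by (simp add: b_def divide_simps)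
    have set: "{x. \<theta>1 * x \<in> cell d (int (Suc j))} = {a<..b}"
      unfolding cell_pos using \<theta>1 by (auto simp: a_def b_def field_simps)
    have "(LINT x:{a<..b}|lborel. f x) = (LINT x:{a<..b}|lborel. x * (v j - \<theta>1 * x) * (1 / (2 * \<kappa>)))"
    proof (intro set_lebesgue_integral_cong)
      show "\<forall>x. x \<in> {a<..b} \<longrightarrow> f x = x * (v j - \<theta>1 * x) * (1 / (2 * \<kappa>))"
      proof (intro allI impI)
        fix x assume x: "x \<in> {a<..b}"
        then have "\<theta>1 * x \<in> {D j<..D (Suc j)}" using \<theta>1 by (auto simp: a_def b_def field_simps)
        then have "err_fun \<theta>1 q x = v j - \<theta>1 * x" using q_cell[OF j] by (simp add: err_fun_def)
        moreover have "marg_density n \<kappa> x = 1 / (2 * \<kappa>)"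
          using x ab b \<kappa> by (simp add: marg_density_eq[OF n \<kappa>] unif_pdf_def)
        ultimately show "f x = x * (v j - \<theta>1 * x) * (1 / (2 * \<kappa>))" by (simp add: f_def)
      qed
    qed simp
    also have "\<dots> = (LINT x:{a<..b}|lborel. x * (v j - \<theta>1 * x)) * (1 / (2 * \<kappa>))"
      by (rule set_integral_mult_left)
    also have "(LINT x:{a<..b}|lborel. x * (v j - \<theta>1 * x)) = 0"
      using cell_moment_zero_iff[OF ab, of "v j" \<theta>1] centroid_scale[OF \<theta>1, of "D j" "D (Suc j)"]
      by (simp add: v_def a_def b_def)
    finally show ?thesis unfolding set by simp
  qed
  have "\<forall>k\<in>{- int m..int m}. (LINT x:{x. \<theta>1 * x \<in> cell d k}|lborel. f x) = 0"
  proof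
    fix k assume "k \<in> {- int m..int m}"
    then show "(LINT x:{x. \<theta>1 * x \<in> cell d k}|lborel. f x) = 0"
    proof (rule cases_int)
      show "(LINT x:{x. \<theta>1 * x \<in> cell d 0}|lborel. f x) = 0"
      proof -
        have "(\<lambda>x. indicator {x. \<theta>1 * x \<in> cell d 0} x *\<^sub>R f x) = (\<lambda>_. 0)"
          using \<theta>1 by (auto simp: cell_def f_def indicator_def)
        then show ?thesis by (simp add: set_lebesgue_integral_def)
      qed
      show "(LINT x:{x. \<theta>1 * x \<in> cell d (int (Suc j))}|lborel. f x) = 0" if "j < m" for j
        by (rule pos[OF that])
      show "(LINT x:{x. \<theta>1 * x \<in> cell d (- int (Suc j))}|lborel. f x) = 0" if "j < m" for j
      proof -
        have "(LINT x:{x. \<theta>1 * x \<in> cell d (- int (Suc j))}|lborel. f x) =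
            (LINT x:{x. \<theta>1 * x \<in> cell d (int (Suc j))}|lborel. f x)"
          unfolding set_lebesgue_integral_def
          by (subst lborel_integral_real_affine[of "-1" _ 0])
            (simp_all only: indicator_def mem_Collect_eq cell_neg cell_pos, simp_all add: f_even)
        then show ?thesis using pos[OF that] by simp
      qed
    qed
  qed
  then have "feasible n \<kappa> \<theta>1 M d q"
    using quant by (simp add: feasible_def f_def flip: m_def)
  moreover have "\<forall>j\<in>{1..<M div 2}. d (int j) = r j * d (int (Suc j))"
    using D_rec d_int(1) by (auto simp only: m_def)
  ultimately show ?thesis by blast
qed

section \<open>Optimal quantizers\<close>

interpretation psi_rec: ratio_recursion 5 "\<lambda>r. psi r 0" psi_min psi_ratio
proof
  show "psi_min 0 = psi 0 0" by (simp add: psi_def)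
  show "psi_min (Suc j) = psi_min j * psi_ratio (Suc j) ^ 5 + psi (psi_ratio (Suc j)) 0" for j
    by (simp add: psi_ratio_def) (simp add: psi_def)
  show "psi_min (Suc j) < psi_min j * r ^ 5 + psi r 0" if "r \<in> {0..1}" "r \<noteq> psi_ratio (Suc j)" for r j
  proof -
    have "psi_min (Suc j) < psi r (psi_min j)" using psi_min_and_ratio[of j] that by blast
    also have "\<dots> = psi_min j * r ^ 5 + psi r 0" by (simp add: psi_def)
    finally show ?thesis .
  qed
qed (use continuous_on_psi psi_min_and_ratio in auto)

interpretation xi_rec: ratio_recursion 3 "\<lambda>r. xi r 0" xi_min xi_ratio
proof
  show "xi_min 0 = xi 0 0" by (simp add: xi_def)
  show "xi_min (Suc j) = xi_min j * xi_ratio (Suc j) ^ 3 + xi (xi_ratio (Suc j)) 0" for j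
    by (simp add: xi_ratio_def) (simp add: xi_def)
  show "xi_min (Suc j) < xi_min j * r ^ 3 + xi r 0" if "r \<in> {0..1}" "r \<noteq> xi_ratio (Suc j)" for r j
  proof -
    have "xi_min (Suc j) < xi r (xi_min j)" using xi_min_and_ratio[of j] that by blast
    also have "\<dots> = xi_min j * r ^ 3 + xi r 0" by (simp add: xi_def)
    finally show ?thesis .
  qed
qed (use continuous_on_xi xi_min_and_ratio in auto)

lemma nested_cost_cong:
  "(\<And>j. j \<in> {1..k} \<Longrightarrow> r j = s j) \<Longrightarrow> nested_cost p c k r = nested_cost p c k s"
  by (induction k) auto

lemma normalized_cost_cong:
  assumes "\<And>j. j \<in> {1..k} \<Longrightarrow> r j = s j"
  shows "normalized_cost n k r = normalized_cost n k s"
  using nested_cost_cong[of k r s, OF assms] by (simp add: normalized_cost_def)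

text \<open>
  After division of the cost by \<open>n - 1\<close>, the contribution of the leading component at the comparison point
  \<open>xi_ratio\<close> is a null sequence, and at \<open>R n\<close> it is nonnegative. The \<open>xi\<close>-cost of \<open>R n\<close> is
  therefore squeezed between its minimum and that minimum plus a null sequence, and
  \<open>ratios_tendsto\<close> applies.
\<close>

lemma near_minimizers_converge:
  assumes R: "\<forall>\<^sub>F n in sequentially. \<forall>j\<in>{1..k}. R n j \<in> {0..1}"
    and le: "\<forall>\<^sub>F n in sequentially. normalized_cost n k (R n) \<le> normalized_cost n k xi_ratio"
  shows "(\<lambda>n. normalized_cost n k (R n) / (real n - 1)) \<longlonglongrightarrow> xi_min k / 108"
    and "\<forall>j\<in>{1..k}. (\<lambda>n. R n j) \<longlonglongrightarrow> xi_ratio j"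
proof -
  let ?P = "nested_cost 5 (\<lambda>r. psi r 0) k" and ?X = "nested_cost 3 (\<lambda>r. xi r 0) k"
  have \<rho>: "xi_ratio j \<in> {0..1}" if "j \<in> {1..k}" for j
    using xi_rec.ratio_pos[of "j - 1"] xi_rec.ratio_less_1[of "j - 1"] that by simp
  have X\<rho>: "?X xi_ratio = xi_min k" using xi_rec.nested_cost_eq_iff[of k xi_ratio] \<rho> by auto
  define U where "U n = ?P xi_ratio / 2160 / (real n - 1) + xi_min k / 108" for n
  have U: "U \<longlonglongrightarrow> xi_min k / 108"
  proof -
    have "(\<lambda>n. 1 / (real n - 1)) \<longlonglongrightarrow> 0" by real_asymp
    from tendsto_mult_right_zero[OF this, of "?P xi_ratio / 2160"]
    have "(\<lambda>n. ?P xi_ratio / 2160 / (real n - 1)) \<longlonglongrightarrow> 0" by simp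
    from tendsto_add[OF this tendsto_const, of "xi_min k / 108"] show ?thesis
      unfolding U_def[abs_def] by simp
  qed
  have bounds: "\<forall>\<^sub>F n in sequentially. xi_min k \<le> ?X (R n) \<and>
      ?X (R n) / 108 \<le> normalized_cost n k (R n) / (real n - 1) \<and>
      normalized_cost n k (R n) / (real n - 1) \<le> U n"
    using R le eventually_gt_at_top[of 1]
  proof eventually_elim
    case (elim n)
    have "psi_min k \<le> ?P (R n)" using elim by (intro psi_rec.nested_cost_ge) auto
    then have P: "0 \<le> ?P (R n)" using psi_min_and_ratio[of k] by linarith
    have X: "xi_min k \<le> ?X (R n)" using elim by (intro xi_rec.nested_cost_ge) auto
    have n: "0 < real n - 1" using elim by simp
    have "(a + c * b / 108) / c = a / c + b / 108" if "0 < c" for a b c :: real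
      using that by (simp add: field_simps)
    from this[OF n] have "normalized_cost n k s / (real n - 1) = ?P s / 2160 / (real n - 1) + ?X s / 108" for s
      unfolding normalized_cost_def .
    moreover have "normalized_cost n k (R n) / (real n - 1) \<le> normalized_cost n k xi_ratio / (real n - 1)"
      using elim n by (intro divide_right_mono) auto
    ultimately show ?case using P X n by (simp add: U_def X\<rho>)
  qed
  show V: "(\<lambda>n. normalized_cost n k (R n) / (real n - 1)) \<longlonglongrightarrow> xi_min k / 108"
    by (rule tendsto_sandwich[OF _ _ tendsto_const U]) (use bounds in \<open>auto elim!: eventually_mono\<close>)
  have "(\<lambda>n. 108 * U n) \<longlonglongrightarrow> 108 * (xi_min k / 108)" by (intro tendsto_intros U)
  then have U': "(\<lambda>n. 108 * U n) \<longlonglongrightarrow> xi_min k" by simp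
  have "(\<lambda>n. ?X (R n)) \<longlonglongrightarrow> xi_min k"
  proof (rule tendsto_sandwich[OF _ _ tendsto_const U'])
    show "\<forall>\<^sub>F n in sequentially. xi_min k \<le> ?X (R n)" using bounds by eventually_elim blast
    show "\<forall>\<^sub>F n in sequentially. ?X (R n) \<le> 108 * U n" using bounds by eventually_elim linarith
  qed
  then show "\<forall>j\<in>{1..k}. (\<lambda>n. R n j) \<longlonglongrightarrow> xi_ratio j"
    using xi_rec.ratios_tendsto[OF R] by blast
qed

text \<open>
  Compactness of the cube of ratios. The minimizer may have ratios \<open>0\<close> or \<open>1\<close> and then describes
  degenerate cells, which no quantizer realizes.
\<close>

lemma normalized_cost_has_minimizer:
  shows "\<exists>r. (\<forall>j. r j \<in> {0..1}) \<and>
    (\<forall>s. (\<forall>j\<in>{1..k}. s j \<in> {0..1}) \<longrightarrow> normalized_cost n k r \<le> normalized_cost n k s)"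
proof -
  let ?K = "(UNIV :: nat set) \<rightarrow>\<^sub>E {0..1::real}"
  have cont: "continuous_on ?K (normalized_cost n k)"
    unfolding normalized_cost_def[abs_def]
    by (intro continuous_intros continuous_on_nested_cost continuous_on_psi continuous_on_xi)
      simp_all
  have "?K \<noteq> {}" by (simp add: PiE_eq_empty_iff)
  from continuous_attains_inf[OF compact_ratio_cube this cont]
  obtain r where r: "r \<in> ?K" "\<And>s. s \<in> ?K \<Longrightarrow> normalized_cost n k r \<le> normalized_cost n k s"
    by blast
  have "normalized_cost n k r \<le> normalized_cost n k s" if s: "\<forall>j\<in>{1..k}. s j \<in> {0..1}" for s
  proof -
    define s' where "s' j = (if j \<in> {1..k} then s j else 0)" for j
    have "normalized_cost n k r \<le> normalized_cost n k s'"
      using s by (intro r(2)) (auto simp: s'_def)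
    also have "\<dots> = normalized_cost n k s" by (rule normalized_cost_cong) (simp add: s'_def)
    finally show ?thesis .
  qed
  moreover have "r j \<in> {0..1}" for j using r(1) by (rule PiE_mem) simp
  ultimately show ?thesis by blast
qed

lemma optimal_iff:
  "optimal n N \<kappa> \<theta>1 M P u \<theta> d q \<longleftrightarrow> feasible n \<kappa> \<theta>1 M d q \<and>
    (\<forall>d' q'. feasible n \<kappa> \<theta>1 M d' q' \<longrightarrow> V_UE n N P u \<theta> q \<le> V_UE n N P u \<theta> q')"
  by (auto simp: optimal_def is_arg_min_def not_less)

lemma feasible_ratios:
  assumes "1 \<le> n" "0 < \<kappa>" "0 < \<theta>1" "feasible n \<kappa> \<theta>1 M d q" and j: "j \<in> {1..<M div 2}"
  shows "0 < d (int (Suc j))" and "d (int j) / d (int (Suc j)) \<in> {0..1}"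
proof -
  note Q = is_quantizerD[of "M div 2" "\<kappa> * \<theta>1" d q]
  have quant: "is_quantizer (M div 2) (\<kappa> * \<theta>1) d q" using assms(4) by (simp add: feasible_def)
  have pos: "0 < d (int j)"
    using partition_less[of "M div 2" "\<lambda>j. d (int j)" 0 j, OF Q(3)[OF quant]] Q(1)[OF quant] j by simp
  moreover have less: "d (int j) < d (int (Suc j))" using Q(3)[OF quant, of j] j by simp
  ultimately show pos': "0 < d (int (Suc j))" by linarith
  have gr: "0 < d (int j) / d (int (Suc j))" using pos pos' by simp
  have ls: "d (int j) / d (int (Suc j)) < 1" using less pos' by simp
  show "d (int j) / d (int (Suc j)) \<in> {0..1}"
    unfolding atLeastAtMost_iff using gr ls by (intro conjI less_imp_le)
qed

text \<open>
  For \<open>n = 1\<close> the \<open>xi\<close>-term of the normalized cost drops out, and the objective is a positive multiple of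
  the nested cost that the \<open>psi\<close>-recursion minimizes.
\<close>

lemma optimal_single_input:
  fixes P :: "'w measure"
  assumes \<kappa>: "0 < \<kappa>" and \<theta>1: "0 < \<theta>1" and M: "2 \<le> M" and N: "1 \<le> N"
    and fir: "fir_model 1 N \<kappa> \<theta>1 P u T \<theta>" and unc: "uncorrelated_in_time 1 N \<kappa> P u T"
  shows "\<exists>d q. optimal 1 N \<kappa> \<theta>1 M P u \<theta> d q"
    and "feasible 1 \<kappa> \<theta>1 M d q \<Longrightarrow> optimal 1 N \<kappa> \<theta>1 M P u \<theta> d q \<longleftrightarrow>
      (\<forall>j\<in>{1..<M div 2}. d (int j) = psi_ratio j * d (int j + 1))"
    and "optimal 1 N \<kappa> \<theta>1 M P u \<theta> d q \<Longrightarrow>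
      V_UE 1 N P u \<theta> q = real N / 2160 * \<theta>1 ^ 2 * \<kappa> ^ 4 * psi_min (M div 2 - 1)"
proof -
  let ?k = "M div 2 - 1"
  have range: "{1..<M div 2} = {1..?k}" using M by auto
  define C where "C = real N / 2160 * \<theta>1 ^ 2 * \<kappa> ^ 4"
  have C: "0 < C" using \<kappa> \<theta>1 N by (simp add: C_def)
  let ?R = "\<lambda>d j. d (int j) / d (int (Suc j))"
  let ?Q = "\<lambda>d. nested_cost 5 (\<lambda>r. psi r 0) ?k (?R d)"
  have V: "V_UE 1 N P u \<theta> q = C * ?Q d" if "feasible 1 \<kappa> \<theta>1 M d q" for d q
    using V_UE_feasible(3)[OF fir unc \<kappa> \<theta>1 M that] by (simp add: normalized_cost_def C_def)
  have ratios: "?R d j \<in> {0..1}" if "feasible 1 \<kappa> \<theta>1 M d q" "j \<in> {1..?k}" for d q j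
    using feasible_ratios(2)[OF _ \<kappa> \<theta>1 that(1), of j] that(2) unfolding range by simp
  have ge: "psi_min ?k \<le> ?Q d" if "feasible 1 \<kappa> \<theta>1 M d q" for d q
    using ratios[OF that] by (intro psi_rec.nested_cost_ge)
  have eq_iff: "?Q d = psi_min ?k \<longleftrightarrow> (\<forall>j\<in>{1..<M div 2}. d (int j) = psi_ratio j * d (int j + 1))"
    if feas: "feasible 1 \<kappa> \<theta>1 M d q" for d q
  proof -
    have "?Q d = psi_min ?k \<longleftrightarrow> (\<forall>j\<in>{1..?k}. ?R d j = psi_ratio j)"
      using ratios[OF feas] by (intro psi_rec.nested_cost_eq_iff)
    also have "\<dots> \<longleftrightarrow> (\<forall>j\<in>{1..<M div 2}. d (int j) = psi_ratio j * d (int j + 1))"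
    proof -
      have "?R d j = psi_ratio j \<longleftrightarrow> d (int j) = psi_ratio j * d (int j + 1)" if j: "j \<in> {1..<M div 2}" for j
        using feasible_ratios(1)[OF _ \<kappa> \<theta>1 feas j] by (simp add: field_simps)
      then show ?thesis unfolding range[symmetric] by blast
    qed
    finally show ?thesis .
  qed
  obtain d0 q0 where opt0: "feasible 1 \<kappa> \<theta>1 M d0 q0" "?Q d0 = psi_min ?k"
  proof -
    have "0 < psi_ratio j \<and> psi_ratio j < 1" if "j \<in> {1..<M div 2}" for j
      using psi_rec.ratio_pos[of "j - 1"] psi_rec.ratio_less_1[of "j - 1"] that by simp
    then obtain d q where dq: "feasible 1 \<kappa> \<theta>1 M d q"
      "\<forall>j\<in>{1..<M div 2}. d (int j) = psi_ratio j * d (int (Suc j))"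
      using feasible_exists[of 1 \<kappa> \<theta>1 M psi_ratio] \<kappa> \<theta>1 M by auto
    moreover have "?Q d = psi_min ?k" using eq_iff[OF dq(1)] dq(2) by (simp add: add.commute)
    ultimately show ?thesis using that by blast
  qed
  have opt_iff: "optimal 1 N \<kappa> \<theta>1 M P u \<theta> d q \<longleftrightarrow> feasible 1 \<kappa> \<theta>1 M d q \<and> ?Q d = psi_min ?k" for d q
  proof
    assume opt: "optimal 1 N \<kappa> \<theta>1 M P u \<theta> d q"
    then have feas: "feasible 1 \<kappa> \<theta>1 M d q" by (simp add: optimal_iff)
    have "V_UE 1 N P u \<theta> q \<le> V_UE 1 N P u \<theta> q0" using opt opt0(1) by (auto simp: optimal_iff)
    then have "?Q d \<le> psi_min ?k" using V[OF feas] V[OF opt0(1)] opt0(2) C by simp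
    then show "feasible 1 \<kappa> \<theta>1 M d q \<and> ?Q d = psi_min ?k" using feas ge[OF feas] by simp
  next
    assume "feasible 1 \<kappa> \<theta>1 M d q \<and> ?Q d = psi_min ?k"
    then show "optimal 1 N \<kappa> \<theta>1 M P u \<theta> d q"
      using V ge C by (auto simp: optimal_iff)
  qed
  show "\<exists>d q. optimal 1 N \<kappa> \<theta>1 M P u \<theta> d q" using opt_iff opt0 by blast
  show "feasible 1 \<kappa> \<theta>1 M d q \<Longrightarrow> optimal 1 N \<kappa> \<theta>1 M P u \<theta> d q \<longleftrightarrow>
      (\<forall>j\<in>{1..<M div 2}. d (int j) = psi_ratio j * d (int j + 1))"
    using opt_iff eq_iff by blast
  show "optimal 1 N \<kappa> \<theta>1 M P u \<theta> d q \<Longrightarrow>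
      V_UE 1 N P u \<theta> q = real N / 2160 * \<theta>1 ^ 2 * \<kappa> ^ 4 * psi_min (M div 2 - 1)"
    using opt_iff[of d q] V[of d q] by (simp add: C_def)
qed

text \<open>
  For existence, the minimizers over the closed cube converge to \<open>xi_ratio\<close>, whose entries lie strictly
  between \<open>0\<close> and \<open>1\<close>; so for large \<open>n\<close> they avoid the degenerate ratios and come from feasible
  quantizers. Any sequence of optimal quantizers beats the one with ratios \<open>xi_ratio\<close>, so it is
  covered by \<open>near_minimizers_converge\<close> as well.
\<close>

lemma optimal_many_inputs:
  fixes P :: "nat \<Rightarrow> 'w measure"
  assumes \<kappa>: "0 < \<kappa>" and \<theta>1: "0 < \<theta>1" and M: "2 \<le> M" and N: "1 \<le> N"
    and fir: "\<And>n. 1 \<le> n \<Longrightarrow> fir_model n N \<kappa> \<theta>1 (P n) (u n) (T n) (\<theta> n)"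
    and unc: "\<And>n. 1 \<le> n \<Longrightarrow> uncorrelated_in_time n N \<kappa> (P n) (u n) (T n)"
  shows "\<forall>\<^sub>F n in sequentially. \<exists>d q. optimal n N \<kappa> \<theta>1 M (P n) (u n) (\<theta> n) d q"
    and "\<forall>\<^sub>F n in sequentially. optimal n N \<kappa> \<theta>1 M (P n) (u n) (\<theta> n) (d n) (q n) \<Longrightarrow>
      \<forall>j\<in>{1..<M div 2}. (\<lambda>n. d n (int j) / d n (int j + 1)) \<longlonglongrightarrow> xi_ratio j"
    and "\<forall>\<^sub>F n in sequentially. optimal n N \<kappa> \<theta>1 M (P n) (u n) (\<theta> n) (d n) (q n) \<Longrightarrow>
      (\<lambda>n. V_UE n N (P n) (u n) (\<theta> n) (q n)) \<sim>[at_top]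
        (\<lambda>n. real N / 108 * \<theta>1 ^ 2 * \<kappa> ^ 4 * (real n - 1) * xi_min (M div 2 - 1))"
proof -
  let ?k = "M div 2 - 1"
  have range: "{1..<M div 2} = {1..?k}" using M by auto
  define C where "C = real N * \<theta>1 ^ 2 * \<kappa> ^ 4"
  have C: "0 < C" using \<kappa> \<theta>1 N by (simp add: C_def)
  let ?R = "\<lambda>d j. d (int j) / d (int (Suc j))"
  have V: "V_UE n N (P n) (u n) (\<theta> n) q = C * normalized_cost n ?k (?R d)"
    if "1 \<le> n" "feasible n \<kappa> \<theta>1 M d q" for n d q
    using V_UE_feasible(3)[OF fir unc \<kappa> \<theta>1 M that(2)] that(1) by (simp add: C_def)
  have ratios: "?R d j \<in> {0..1}" if "1 \<le> n" "feasible n \<kappa> \<theta>1 M d q" "j \<in> {1..?k}" for n d q j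
    using feasible_ratios(2)[OF that(1) \<kappa> \<theta>1 that(2), of j] that(3) unfolding range by simp
  have ex: "\<exists>d q. feasible n \<kappa> \<theta>1 M d q \<and> normalized_cost n ?k (?R d) = normalized_cost n ?k r"
    if n: "1 \<le> n" and r: "\<And>j. j \<in> {1..?k} \<Longrightarrow> 0 < r j \<and> r j < 1" for n and r :: "nat \<Rightarrow> real"
  proof -
    obtain d q where dq: "feasible n \<kappa> \<theta>1 M d q" "\<forall>j\<in>{1..<M div 2}. d (int j) = r j * d (int (Suc j))"
      using feasible_exists[OF n \<kappa> \<theta>1 M, of r] r unfolding range by blast
    have "?R d j = r j" if "j \<in> {1..?k}" for j
      using feasible_ratios(1)[OF n \<kappa> \<theta>1 dq(1), of j] dq(2) that unfolding range by auto
    then have "normalized_cost n ?k (?R d) = normalized_cost n ?k r" by (rule normalized_cost_cong)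
    then show ?thesis using dq(1) by blast
  qed
  have \<rho>: "0 < xi_ratio j \<and> xi_ratio j < 1" if "j \<in> {1..?k}" for j
    using xi_rec.ratio_pos[of "j - 1"] xi_rec.ratio_less_1[of "j - 1"] that by simp
  show "\<forall>\<^sub>F n in sequentially. \<exists>d q. optimal n N \<kappa> \<theta>1 M (P n) (u n) (\<theta> n) d q"
  proof -
    have "\<forall>n. \<exists>r. (\<forall>j. r j \<in> {0..1}) \<and>
      (\<forall>s. (\<forall>j\<in>{1..?k}. s j \<in> {0..1}) \<longrightarrow> normalized_cost n ?k r \<le> normalized_cost n ?k s)"
      using normalized_cost_has_minimizer by blast
    then obtain r where r: "\<And>n j. r n j \<in> {0..1}"
      and min: "\<And>n s. (\<forall>j\<in>{1..?k}. s j \<in> {0..1}) \<Longrightarrow> normalized_cost n ?k (r n) \<le> normalized_cost n ?k s"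
      by metis
    have "\<forall>j\<in>{1..?k}. xi_ratio j \<in> {0..1}" using \<rho> by (simp add: less_imp_le)
    then have "\<forall>\<^sub>F n in sequentially. normalized_cost n ?k (r n) \<le> normalized_cost n ?k xi_ratio"
      by (intro always_eventually allI min)
    then have "\<forall>j\<in>{1..?k}. (\<lambda>n. r n j) \<longlonglongrightarrow> xi_ratio j"
      by (rule near_minimizers_converge(2)[rotated]) (use r in simp)
    then have "\<forall>\<^sub>F n in sequentially. \<forall>j\<in>{1..?k}. 0 < r n j \<and> r n j < 1"
      using \<rho> by (intro eventually_ball_finite ballI eventually_conj) (auto dest!: bspec simp: order_tendsto_iff)
    then show ?thesis
      using eventually_ge_at_top[of 1]
    proof eventually_elim
      case (elim n)
      then obtain d q where dq: "feasible n \<kappa> \<theta>1 M d q"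
        "normalized_cost n ?k (?R d) = normalized_cost n ?k (r n)"
        using ex[of n "r n"] by auto
      have "V_UE n N (P n) (u n) (\<theta> n) q \<le> V_UE n N (P n) (u n) (\<theta> n) q'"
        if feas: "feasible n \<kappa> \<theta>1 M d' q'" for d' q'
      proof -
        have "normalized_cost n ?k (r n) \<le> normalized_cost n ?k (?R d')"
          using ratios[OF elim(2) feas] by (intro min ballI)
        then show ?thesis
          unfolding V[OF elim(2) dq(1)] V[OF elim(2) feas] dq(2) using C by (intro mult_left_mono) auto
      qed
      then show ?case using dq(1) by (auto simp: optimal_iff)
    qed
  qed
  assume opt: "\<forall>\<^sub>F n in sequentially. optimal n N \<kappa> \<theta>1 M (P n) (u n) (\<theta> n) (d n) (q n)"
  have ev: "\<forall>\<^sub>F n in sequentially. (\<forall>j\<in>{1..?k}. ?R (d n) j \<in> {0..1}) \<and>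
      normalized_cost n ?k (?R (d n)) \<le> normalized_cost n ?k xi_ratio \<and>
      V_UE n N (P n) (u n) (\<theta> n) (q n) = C * normalized_cost n ?k (?R (d n))"
    using opt eventually_ge_at_top[of 1]
  proof eventually_elim
    case (elim n)
    then have feas: "feasible n \<kappa> \<theta>1 M (d n) (q n)" by (simp add: optimal_iff)
    obtain d0 q0 where dq0: "feasible n \<kappa> \<theta>1 M d0 q0"
      "normalized_cost n ?k (?R d0) = normalized_cost n ?k xi_ratio"
      using ex[of n xi_ratio] elim(2) \<rho> by blast
    have "V_UE n N (P n) (u n) (\<theta> n) (q n) \<le> V_UE n N (P n) (u n) (\<theta> n) q0"
      using elim(1) dq0(1) by (auto simp: optimal_iff)
    then have "normalized_cost n ?k (?R (d n)) \<le> normalized_cost n ?k xi_ratio"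
      unfolding V[OF elim(2) feas] V[OF elim(2) dq0(1)] dq0(2) using C by simp
    then show ?case using ratios[OF elim(2) feas] V[OF elim(2) feas] by blast
  qed
  have ev1: "\<forall>\<^sub>F n in sequentially. \<forall>j\<in>{1..?k}. ?R (d n) j \<in> {0..1}"
    and ev2: "\<forall>\<^sub>F n in sequentially. normalized_cost n ?k (?R (d n)) \<le> normalized_cost n ?k xi_ratio"
    and ev3: "\<forall>\<^sub>F n in sequentially. V_UE n N (P n) (u n) (\<theta> n) (q n) = C * normalized_cost n ?k (?R (d n))"
    using ev by (auto elim: eventually_mono)
  note lim = near_minimizers_converge[OF ev1 ev2]
  show "\<forall>j\<in>{1..<M div 2}. (\<lambda>n. d n (int j) / d n (int j + 1)) \<longlonglongrightarrow> xi_ratio j"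
    unfolding range using lim(2) by (simp add: add.commute)
  show "(\<lambda>n. V_UE n N (P n) (u n) (\<theta> n) (q n)) \<sim>[at_top]
        (\<lambda>n. real N / 108 * \<theta>1 ^ 2 * \<kappa> ^ 4 * (real n - 1) * xi_min ?k)"
  proof (rule asymp_equivI')
    have pos: "0 < xi_min ?k" using xi_min_and_ratio by blast
    have "(\<lambda>n. normalized_cost n ?k (?R (d n)) / (real n - 1) * (108 / xi_min ?k))
        \<longlonglongrightarrow> xi_min ?k / 108 * (108 / xi_min ?k)"
      by (intro tendsto_intros lim(1))
    then have "(\<lambda>n. normalized_cost n ?k (?R (d n)) / (real n - 1) * (108 / xi_min ?k)) \<longlonglongrightarrow> 1"
      using pos by simp
    moreover have "\<forall>\<^sub>F n in sequentially. normalized_cost n ?k (?R (d n)) / (real n - 1) * (108 / xi_min ?k) =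
        V_UE n N (P n) (u n) (\<theta> n) (q n) / (real N / 108 * \<theta>1 ^ 2 * \<kappa> ^ 4 * (real n - 1) * xi_min ?k)"
      using ev3 eventually_gt_at_top[of 1]
    proof eventually_elim
      case (elim n)
      show ?case unfolding elim(1) C_def using elim(2) pos \<kappa> \<theta>1 N by (simp add: field_simps)
    qed
    ultimately show "(\<lambda>n. V_UE n N (P n) (u n) (\<theta> n) (q n) /
        (real N / 108 * \<theta>1 ^ 2 * \<kappa> ^ 4 * (real n - 1) * xi_min ?k)) \<longlonglongrightarrow> 1"
      by (rule Lim_transform_eventually)
  qed
qed

theorem theorem4p1:
  fixes \<kappa> \<theta>1 :: real and M N :: nat
  assumes "\<kappa> > 0" and "\<theta>1 > 0" and "M \<ge> 2" and "N \<ge> 1"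
  shows
    "(\<forall>n (P :: 'w measure) u T \<theta> d q.
        fir_model n N \<kappa> \<theta>1 P u T \<theta> \<and> uncorrelated_in_time n N \<kappa> P u T \<and> feasible n \<kappa> \<theta>1 M d q \<longrightarrow>
          V_UE n N P u \<theta> q = V_rot_UE n N P u T \<theta> q \<and>
          V_rot_UE n N P u T \<theta> q =
            (\<Sum>k<n. \<integral>\<omega>. (\<Sum>t=1..N. rot_regressor n u T \<omega> t k *
               err_fun \<theta>1 q (rot_regressor n u T \<omega> t 0))\<^sup>2 \<partial>P) \<and>
          V_rot_UE n N P u T \<theta> q =
            real N * (\<integral>x. sigma_sq n \<kappa> x * (err_fun \<theta>1 q x)\<^sup>2 * marg_density n \<kappa> x \<partial>lborel)) \<and>
    (\<forall>j\<ge>1. \<forall>r.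
        is_arg_min (\<lambda>r. psi r (psi_min (j - 1))) (\<lambda>r. r \<in> {0..1}) r \<longleftrightarrow> r = psi_ratio j) \<and>
    (\<forall>j\<ge>1. \<forall>r.
        is_arg_min (\<lambda>r. xi r (xi_min (j - 1))) (\<lambda>r. r \<in> {0..1}) r \<longleftrightarrow> r = xi_ratio j) \<and>
    (\<forall>(P :: 'w measure) u T \<theta>.
        fir_model 1 N \<kappa> \<theta>1 P u T \<theta> \<and> uncorrelated_in_time 1 N \<kappa> P u T \<longrightarrow>
          (\<exists>d q. optimal 1 N \<kappa> \<theta>1 M P u \<theta> d q) \<and>
          (\<forall>d q. feasible 1 \<kappa> \<theta>1 M d q \<longrightarrow>
             (optimal 1 N \<kappa> \<theta>1 M P u \<theta> d q \<longleftrightarrow>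
               (\<forall>j\<in>{1..<M div 2}. d (int j) = psi_ratio j * d (int j + 1)))) \<and>
          (\<forall>d q. optimal 1 N \<kappa> \<theta>1 M P u \<theta> d q \<longrightarrow>
             V_UE 1 N P u \<theta> q = real N / 2160 * \<theta>1 ^ 2 * \<kappa> ^ 4 * psi_min (M div 2 - 1))) \<and>
    (\<forall>(P :: nat \<Rightarrow> 'w measure) u T \<theta>.
        (\<forall>n\<ge>1. fir_model n N \<kappa> \<theta>1 (P n) (u n) (T n) (\<theta> n) \<and>
                uncorrelated_in_time n N \<kappa> (P n) (u n) (T n)) \<longrightarrow>
          (\<forall>\<^sub>F n in sequentially. \<exists>d q. optimal n N \<kappa> \<theta>1 M (P n) (u n) (\<theta> n) d q) \<and>
          (\<forall>d q. (\<forall>\<^sub>F n in sequentially. optimal n N \<kappa> \<theta>1 M (P n) (u n) (\<theta> n) (d n) (q n)) \<longrightarrow>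
             (\<forall>j\<in>{1..<M div 2}. (\<lambda>n. d n (int j) / d n (int j + 1)) \<longlonglongrightarrow> xi_ratio j) \<and>
             (\<lambda>n. V_UE n N (P n) (u n) (\<theta> n) (q n)) \<sim>[at_top]
               (\<lambda>n. real N / 108 * \<theta>1 ^ 2 * \<kappa> ^ 4 * (real n - 1) * xi_min (M div 2 - 1))))"
proof (intro conjI)
  note \<kappa> = assms(1) and \<theta>1 = assms(2) and M = assms(3) and N = assms(4)
  show "\<forall>n (P :: 'w measure) u T \<theta> d q.
        fir_model n N \<kappa> \<theta>1 P u T \<theta> \<and> uncorrelated_in_time n N \<kappa> P u T \<and> feasible n \<kappa> \<theta>1 M d q \<longrightarrow>
          V_UE n N P u \<theta> q = V_rot_UE n N P u T \<theta> q \<and>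
          V_rot_UE n N P u T \<theta> q =
            (\<Sum>k<n. \<integral>\<omega>. (\<Sum>t=1..N. rot_regressor n u T \<omega> t k *
               err_fun \<theta>1 q (rot_regressor n u T \<omega> t 0))\<^sup>2 \<partial>P) \<and>
          V_rot_UE n N P u T \<theta> q =
            real N * (\<integral>x. sigma_sq n \<kappa> x * (err_fun \<theta>1 q x)\<^sup>2 * marg_density n \<kappa> x \<partial>lborel)"
  proof (intro allI impI, elim conjE)
    fix n :: nat and P :: "'w measure" and u T \<theta> d q
    assume model: "fir_model n N \<kappa> \<theta>1 P u T \<theta>" "uncorrelated_in_time n N \<kappa> P u T"
      and feas: "feasible n \<kappa> \<theta>1 M d q"
    show "V_UE n N P u \<theta> q = V_rot_UE n N P u T \<theta> q \<and>
          V_rot_UE n N P u T \<theta> q =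
            (\<Sum>k<n. \<integral>\<omega>. (\<Sum>t=1..N. rot_regressor n u T \<omega> t k *
               err_fun \<theta>1 q (rot_regressor n u T \<omega> t 0))\<^sup>2 \<partial>P) \<and>
          V_rot_UE n N P u T \<theta> q =
            real N * (\<integral>x. sigma_sq n \<kappa> x * (err_fun \<theta>1 q x)\<^sup>2 * marg_density n \<kappa> x \<partial>lborel)"
      by (intro conjI V_UE_eq_V_rot_UE[OF model(1)] V_UE_feasible(1,2)[OF model \<kappa> \<theta>1 M feas])
  qed
  show "\<forall>j\<ge>1. \<forall>r. is_arg_min (\<lambda>r. psi r (psi_min (j - 1))) (\<lambda>r. r \<in> {0..1}) r \<longleftrightarrow> r = psi_ratio j"
  proof (intro allI impI is_arg_min_unique_iff)
    fix j :: nat assume "1 \<le> j"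
    then obtain i where j: "j = Suc i" by (cases j) auto
    note R = psi_min_and_ratio[of i]
    show "psi_ratio j \<in> {0..1}" using R by (simp add: j)
    have "psi (psi_ratio j) (psi_min (j - 1)) = psi_min j" by (simp add: j psi_ratio_def)
    then show "psi (psi_ratio j) (psi_min (j - 1)) < psi x (psi_min (j - 1))"
      if "x \<in> {0..1}" "x \<noteq> psi_ratio j" for x
      using R that unfolding j by auto
  qed
  show "\<forall>j\<ge>1. \<forall>r. is_arg_min (\<lambda>r. xi r (xi_min (j - 1))) (\<lambda>r. r \<in> {0..1}) r \<longleftrightarrow> r = xi_ratio j"
  proof (intro allI impI is_arg_min_unique_iff)
    fix j :: nat assume "1 \<le> j"
    then obtain i where j: "j = Suc i" by (cases j) auto
    note R = xi_min_and_ratio[of i]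
    show "xi_ratio j \<in> {0..1}" using R by (simp add: j)
    have "xi (xi_ratio j) (xi_min (j - 1)) = xi_min j" by (simp add: j xi_ratio_def)
    then show "xi (xi_ratio j) (xi_min (j - 1)) < xi x (xi_min (j - 1))"
      if "x \<in> {0..1}" "x \<noteq> xi_ratio j" for x
      using R that unfolding j by auto
  qed
  show "\<forall>(P :: 'w measure) u T \<theta>.
        fir_model 1 N \<kappa> \<theta>1 P u T \<theta> \<and> uncorrelated_in_time 1 N \<kappa> P u T \<longrightarrow>
          (\<exists>d q. optimal 1 N \<kappa> \<theta>1 M P u \<theta> d q) \<and>
          (\<forall>d q. feasible 1 \<kappa> \<theta>1 M d q \<longrightarrow>
             (optimal 1 N \<kappa> \<theta>1 M P u \<theta> d q \<longleftrightarrow>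
               (\<forall>j\<in>{1..<M div 2}. d (int j) = psi_ratio j * d (int j + 1)))) \<and>
          (\<forall>d q. optimal 1 N \<kappa> \<theta>1 M P u \<theta> d q \<longrightarrow>
             V_UE 1 N P u \<theta> q = real N / 2160 * \<theta>1 ^ 2 * \<kappa> ^ 4 * psi_min (M div 2 - 1))"
  proof (intro allI impI, elim conjE)
    fix P :: "'w measure" and u T \<theta>
    assume "fir_model 1 N \<kappa> \<theta>1 P u T \<theta>" "uncorrelated_in_time 1 N \<kappa> P u T"
    note opt = optimal_single_input[OF assms this]
    show "(\<exists>d q. optimal 1 N \<kappa> \<theta>1 M P u \<theta> d q) \<and>
          (\<forall>d q. feasible 1 \<kappa> \<theta>1 M d q \<longrightarrow>
             (optimal 1 N \<kappa> \<theta>1 M P u \<theta> d q \<longleftrightarrow>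
               (\<forall>j\<in>{1..<M div 2}. d (int j) = psi_ratio j * d (int j + 1)))) \<and>
          (\<forall>d q. optimal 1 N \<kappa> \<theta>1 M P u \<theta> d q \<longrightarrow>
             V_UE 1 N P u \<theta> q = real N / 2160 * \<theta>1 ^ 2 * \<kappa> ^ 4 * psi_min (M div 2 - 1))"
      by (intro conjI allI impI opt)
  qed
  show "\<forall>(P :: nat \<Rightarrow> 'w measure) u T \<theta>.
        (\<forall>n\<ge>1. fir_model n N \<kappa> \<theta>1 (P n) (u n) (T n) (\<theta> n) \<and>
                uncorrelated_in_time n N \<kappa> (P n) (u n) (T n)) \<longrightarrow>
          (\<forall>\<^sub>F n in sequentially. \<exists>d q. optimal n N \<kappa> \<theta>1 M (P n) (u n) (\<theta> n) d q) \<and>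
          (\<forall>d q. (\<forall>\<^sub>F n in sequentially. optimal n N \<kappa> \<theta>1 M (P n) (u n) (\<theta> n) (d n) (q n)) \<longrightarrow>
             (\<forall>j\<in>{1..<M div 2}. (\<lambda>n. d n (int j) / d n (int j + 1)) \<longlonglongrightarrow> xi_ratio j) \<and>
             (\<lambda>n. V_UE n N (P n) (u n) (\<theta> n) (q n)) \<sim>[at_top]
               (\<lambda>n. real N / 108 * \<theta>1 ^ 2 * \<kappa> ^ 4 * (real n - 1) * xi_min (M div 2 - 1)))"
  proof (intro allI impI)
    fix P :: "nat \<Rightarrow> 'w measure" and u T \<theta>
    assume model: "\<forall>n\<ge>1. fir_model n N \<kappa> \<theta>1 (P n) (u n) (T n) (\<theta> n) \<and>
                uncorrelated_in_time n N \<kappa> (P n) (u n) (T n)"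
    have fir: "fir_model n N \<kappa> \<theta>1 (P n) (u n) (T n) (\<theta> n)"
      and unc: "uncorrelated_in_time n N \<kappa> (P n) (u n) (T n)" if "1 \<le> n" for n
      using model that by auto
    note opt = optimal_many_inputs[OF assms fir unc]
    show "(\<forall>\<^sub>F n in sequentially. \<exists>d q. optimal n N \<kappa> \<theta>1 M (P n) (u n) (\<theta> n) d q) \<and>
          (\<forall>d q. (\<forall>\<^sub>F n in sequentially. optimal n N \<kappa> \<theta>1 M (P n) (u n) (\<theta> n) (d n) (q n)) \<longrightarrow>
             (\<forall>j\<in>{1..<M div 2}. (\<lambda>n. d n (int j) / d n (int j + 1)) \<longlonglongrightarrow> xi_ratio j) \<and>
             (\<lambda>n. V_UE n N (P n) (u n) (\<theta> n) (q n)) \<sim>[at_top]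
               (\<lambda>n. real N / 108 * \<theta>1 ^ 2 * \<kappa> ^ 4 * (real n - 1) * xi_min (M div 2 - 1)))"
      by (intro conjI allI impI opt)
  qed
qed

end
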